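(* Let $\alpha\in(1,2)$, $\beta\in\mathbb{R}$, $\sigma\in\mathbb{R}\setminus\{0\}$, let $(L^\alpha_t)_{t\in\mathbb{R}}$ be either the truncated or the non-truncated $\alpha$-stable process on $\mathbb{R}$, and let $\varphi$ be the random dynamical system generated by $$\mathrm{d}X_t=(\beta X_t-X_t^3)\,\mathrm{d}t+\sigma\,\mathrm{d}L^\alpha_t,\qquad X_0\in\mathbb{R}.$$ Then $\varphi$ has a compact random attractor $\mathcal{A}(\omega)$ consisting of a singleton, $\mathcal{A}(\omega)=\{a(\omega)\}$. Furthermore, the invariant Markov measure $\mu$ with $\mu_\omega=\delta_{a(\omega)}$ is the unique invariant measure of the random dynamical system $\varphi$.
   Context: Noise. For $\alpha\in(0,2)$ let $\nu_\alpha(\mathrm{d}z)=c_\alpha|z|^{-1-\alpha}\,\mathrm{d}z$ on $\mathbb{R}\setminus\{0\}$, $c_\alpha=\frac{\alpha}{2^{1-\alpha}\pi^{1/2}}\frac{\Gamma((1+\alpha)/2)}{\Gamma(1-\alpha/2)}$. Let $N$ be the Poisson random measure of jumps and $\widetilde N(t,\mathrm{d}z)=N(t,\mathrm{d}z)-t\nu(\mathrm{d}z)$. The non-truncated process is the two-sided symmetric $\alpha$-stable Lévy process, with $\nu=\nu_\alpha$ and $L_t=\int_{|z|<1}z\,\widetilde N(t,\mathrm{d}z)+\int_{|z|\ge1}z\,N(t,\mathrm{d}z)$. The truncated process is the two-sided Lévy process with $\nu=\nu_\alpha|_{\{|z|<1\}}$ and $L_t=\int_{|z|<1}z\,\widetilde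 N(t,\mathrm{d}z)$. Random dynamical system. $(\Omega,\mathcal F,\mathbb P)$ is the canonical space of two-sided càdlàg paths with $L_t(\omega)=\omega(t)$, $\omega(0)=0$, and $\theta_t\omega(\cdot)=\omega(t+\cdot)-\omega(t)$. The equation generates a random dynamical system (cocycle) $\varphi$ over $\theta$: $\varphi(t,\omega,x)$ is the solution at time $t\ge0$ started at $x$ at time $0$. Random attractor. A random attractor for $\varphi$ is a compact random set $A$ such that $\mathbb P$-a.s.: (i) $\varphi(t,\omega)A(\omega)=A(\theta_t\omega)$ for all $t>0$; (ii) for every deterministic bounded set $B\subset\mathbb{R}$, $\lim_{t\to\infty}d(\varphi(t,\theta_{-t}\omega)B,A(\omega))=0$, where $d(B,A)=\sup_{x\in B}\inf_{y\in A}|x-y|$. Invariant measures. An invariant measure for $\varphi$ is a probability measure $\mu$ on $\Omega\times\mathbb{R}$ with $\Omega$-marginal $\mathbb P$ that is invariant under the skew product $\Theta(t)(\omega,x)=(\theta_t\omega,\varphi(t,\omega,x))$ for all $t\ge 0$; $\omega\mapsto\mu_\omega$ denotes its disintegration with respect to $\mathbb P$. It is called a (forward) Markov measure if $\omega\mapsto\mu_\omega$ is measurable with respect to the past $\sigma$-algebra $\mathcal F^-$ generated by $(L_s)_{s\le0}$ (up to null sets). *)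

theory Defs
  imports "HOL-Probability.Probability"
begin

definition cadlag :: "(real \<Rightarrow> real) \<Rightarrow> bool" where
  "cadlag \<omega> \<longleftrightarrow>
     (\<forall>t. (\<omega> \<longlongrightarrow> \<omega> t) (at_right t) \<and> (\<exists>l. (\<omega> \<longlongrightarrow> l) (at_left t)))"

definition paths :: "(real \<Rightarrow> real) set" where
  "paths = {\<omega>. cadlag \<omega> \<and> \<omega> 0 = 0}"

text \<open>Only the carrier \<^term>\<open>paths\<close> and the \<open>\<sigma>\<close>-algebra generated by the coordinates
  \<open>L\<^sub>t(\<omega>) = \<omega> t\<close> matter here; the underlying measure plays no role.\<close>

definition path_space :: "(real \<Rightarrow> real) measure" where
  "path_space = restrict_space (Pi\<^sub>M UNIV (\<lambda>_. borel)) paths"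

definition past :: "(real \<Rightarrow> real) measure" where
  "past = sigma paths {{\<omega> \<in> paths. \<omega> s \<in> B} | s B. s \<le> 0 \<and> B \<in> sets borel}"

definition shift :: "real \<Rightarrow> (real \<Rightarrow> real) \<Rightarrow> real \<Rightarrow> real" where
  "shift t \<omega> = (\<lambda>s. \<omega> (t + s) - \<omega> t)"

definition stable_const :: "real \<Rightarrow> real" where
  "stable_const \<alpha> =
     \<alpha> / (2 powr (1 - \<alpha>) * pi powr (1 / 2)) * (Gamma ((1 + \<alpha>) / 2) / Gamma (1 - \<alpha> / 2))"

text \<open>Levy measures on \<open>\<real> \<setminus> {0}\<close> are regarded as measures on \<open>\<real>\<close> that do not charge \<open>0\<close>.\<close>

definition stable_measure :: "real \<Rightarrow> real measure" where
  "stable_measure \<alpha> =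
     density lborel
       (\<lambda>z. ennreal (stable_const \<alpha> * \<bar>z\<bar> powr (- 1 - \<alpha>)) * indicator (- {0}) z)"

definition truncated_stable_measure :: "real \<Rightarrow> real measure" where
  "truncated_stable_measure \<alpha> = density (stable_measure \<alpha>) (indicator {z. \<bar>z\<bar> < 1})"

definition jump :: "(real \<Rightarrow> real) \<Rightarrow> real \<Rightarrow> real" where
  "jump \<omega> s = \<omega> s - Lim (at_left s) \<omega>"

text \<open>The random measure \<open>N = \<Sum>\<^sub>s \<delta>\<^bsub>(s, \<Delta>L\<^sub>s)\<^esub>\<close> on \<open>\<real> \<times> \<real>\<close>, the sum ranging over the jump times.\<close>

definition jump_measure :: "(real \<Rightarrow> real) \<Rightarrow> (real \<times> real) measure" where
  "jump_measure \<omega> = distr (count_space {s. jump \<omega> s \<noteq> 0}) borel (\<lambda>s. (s, jump \<omega> s))"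

definition poisson_random_measure ::
    "'w measure \<Rightarrow> ('w \<Rightarrow> (real \<times> real) measure) \<Rightarrow> (real \<times> real) measure \<Rightarrow> bool" where
  "poisson_random_measure P N m \<longleftrightarrow>
     (\<forall>E :: nat \<Rightarrow> (real \<times> real) set. range E \<subseteq> sets borel \<and> disjoint_family E \<longrightarrow>
        prob_space.indep_vars P (\<lambda>_. borel) (\<lambda>i \<omega>. emeasure (N \<omega>) (E i)) UNIV) \<and>
     (\<forall>E \<in> sets borel. emeasure m E < \<infinity> \<longrightarrow>
        (\<forall>k::nat. measure P {\<omega> \<in> space P. emeasure (N \<omega>) E = of_nat k}
           = measure m E ^ k / fact k * exp (- measure m E)))"

definition two_sided_levy_process :: "(real \<Rightarrow> real) measure \<Rightarrow> bool" where
  "two_sided_levy_process P \<longleftrightarrow>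
     prob_space P \<and> sets P = sets path_space \<and>
     (\<forall>\<tau> :: nat \<Rightarrow> real. mono \<tau> \<longrightarrow>
        prob_space.indep_vars P (\<lambda>_. borel) (\<lambda>i \<omega>. \<omega> (\<tau> (Suc i)) - \<omega> (\<tau> i)) UNIV) \<and>
     (\<forall>s t h. distr P borel (\<lambda>\<omega>. \<omega> (t + h) - \<omega> (s + h)) = distr P borel (\<lambda>\<omega>. \<omega> t - \<omega> s))"

definition levy_jump_process :: "(real \<Rightarrow> real) measure \<Rightarrow> real measure \<Rightarrow> bool" where
  "levy_jump_process P \<nu> \<longleftrightarrow>
     two_sided_levy_process P \<and> poisson_random_measure P jump_measure (lborel \<Otimes>\<^sub>M \<nu>)"

text \<open>\<open>Y\<close> is (a version of) \<open>\<integral>\<^bsub>|z| < 1\<^esub> z (N((s,t], dz) - (t - s) \<nu>(dz))\<close>: the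
  \<open>L\<^sup>2\<close>-limit, as \<open>\<epsilon>\<close> decreases to \<open>0\<close>, of the integrals over \<open>\<epsilon> \<le> |z| < 1\<close>.\<close>

definition compensated_integral ::
    "(real \<Rightarrow> real) measure \<Rightarrow> real measure \<Rightarrow> real \<Rightarrow> real \<Rightarrow> ((real \<Rightarrow> real) \<Rightarrow> real) \<Rightarrow> bool" where
  "compensated_integral P \<nu> s t Y \<longleftrightarrow>
     Y \<in> borel_measurable P \<and>
     ((\<lambda>\<epsilon>. \<integral>\<^sup>+ \<omega>. ennreal ((Y \<omega>
          - ((LINT p:({s<..t} \<times> {z. \<epsilon> \<le> \<bar>z\<bar> \<and> \<bar>z\<bar> < 1})|jump_measure \<omega>. snd p)
             - (t - s) * (LINT z:{z. \<epsilon> \<le> \<bar>z\<bar> \<and> \<bar>z\<bar> < 1}|\<nu>. z)))\<^sup>2) \<partial>P)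
        \<longlongrightarrow> 0) (at_right 0)"

text \<open>The Levy-Ito representations are stated for increments \<open>L\<^sub>t - L\<^sub>s\<close>, \<open>s \<le> t\<close>; since
  \<open>L\<^sub>0 = 0\<close> this covers both positive and negative times.\<close>

definition stable_noise :: "real \<Rightarrow> (real \<Rightarrow> real) measure \<Rightarrow> bool" where
  "stable_noise \<alpha> P \<longleftrightarrow>
     levy_jump_process P (stable_measure \<alpha>) \<and>
     (\<forall>s t. s \<le> t \<longrightarrow> (\<exists>Y. compensated_integral P (stable_measure \<alpha>) s t Y \<and>
        (AE \<omega> in P. \<omega> t - \<omega> s
           = Y \<omega> + (LINT p:({s<..t} \<times> {z. 1 \<le> \<bar>z\<bar>})|jump_measure \<omega>. snd p))))"

definition truncated_stable_noise :: "real \<Rightarrow> (real \<Rightarrow> real) measure \<Rightarrow> bool" where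
  "truncated_stable_noise \<alpha> P \<longleftrightarrow>
     levy_jump_process P (truncated_stable_measure \<alpha>) \<and>
     (\<forall>s t. s \<le> t \<longrightarrow> (\<exists>Y. compensated_integral P (truncated_stable_measure \<alpha>) s t Y \<and>
        (AE \<omega> in P. \<omega> t - \<omega> s = Y \<omega>)))"

text \<open>Only the values \<open>\<phi> t \<omega> x\<close> with \<open>t \<ge> 0\<close> and \<open>\<omega> \<in> paths\<close> are relevant.\<close>

type_synonym cocycle = "real \<Rightarrow> (real \<Rightarrow> real) \<Rightarrow> real \<Rightarrow> real"

definition random_dynamical_system :: "cocycle \<Rightarrow> bool" where
  "random_dynamical_system \<phi> \<longleftrightarrow>
     (\<lambda>(t, \<omega>, x). \<phi> t \<omega> x)
        \<in> borel_measurable (restrict_space borel {0..} \<Otimes>\<^sub>M (path_space \<Otimes>\<^sub>M borel)) \<and>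
     (\<forall>\<omega>\<in>paths. \<forall>x. \<phi> 0 \<omega> x = x) \<and>
     (\<forall>\<omega>\<in>paths. \<forall>s\<ge>0. \<forall>t\<ge>0. \<forall>x. \<phi> (s + t) \<omega> x = \<phi> t (shift s \<omega>) (\<phi> s \<omega> x))"

text \<open>The noise being additive, \<open>dX = b(X) dt + \<sigma> dL\<close>, \<open>X\<^sub>0 = x\<close> is a pathwise integral equation.\<close>

definition generated_by_sde :: "(real \<Rightarrow> real) \<Rightarrow> real \<Rightarrow> cocycle \<Rightarrow> bool" where
  "generated_by_sde b \<sigma> \<phi> \<longleftrightarrow>
     random_dynamical_system \<phi> \<and>
     (\<forall>\<omega>\<in>paths. \<forall>x. \<forall>t\<ge>0.
        ((\<lambda>s. b (\<phi> s \<omega> x)) has_integral (\<phi> t \<omega> x - x - \<sigma> * \<omega> t)) {0..t})"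

definition set_dist :: "real \<Rightarrow> real set \<Rightarrow> ennreal" where
  "set_dist x A = (INF y\<in>A. ennreal \<bar>x - y\<bar>)"

definition semi_dist :: "real set \<Rightarrow> real set \<Rightarrow> ennreal" where
  "semi_dist B A = (SUP x\<in>B. set_dist x A)"

definition compact_random_set ::
    "(real \<Rightarrow> real) measure \<Rightarrow> ((real \<Rightarrow> real) \<Rightarrow> real set) \<Rightarrow> bool" where
  "compact_random_set P A \<longleftrightarrow>
     (\<forall>\<omega>\<in>space P. compact (A \<omega>)) \<and> (\<forall>x. (\<lambda>\<omega>. set_dist x (A \<omega>)) \<in> borel_measurable P)"

definition random_attractor ::
    "(real \<Rightarrow> real) measure \<Rightarrow> cocycle \<Rightarrow> ((real \<Rightarrow> real) \<Rightarrow> real set) \<Rightarrow> bool" where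
  "random_attractor P \<phi> A \<longleftrightarrow>
     compact_random_set P A \<and>
     (AE \<omega> in P.
        (\<forall>t>0. \<phi> t \<omega> ` A \<omega> = A (shift t \<omega>)) \<and>
        (\<forall>B. bounded B \<longrightarrow>
           ((\<lambda>t. semi_dist (\<phi> t (shift (- t) \<omega>) ` B) (A \<omega>)) \<longlongrightarrow> 0) at_top))"

definition skew_product ::
    "cocycle \<Rightarrow> real \<Rightarrow> (real \<Rightarrow> real) \<times> real \<Rightarrow> (real \<Rightarrow> real) \<times> real" where
  "skew_product \<phi> t = (\<lambda>(\<omega>, x). (shift t \<omega>, \<phi> t \<omega> x))"

definition invariant_measure ::
    "(real \<Rightarrow> real) measure \<Rightarrow> cocycle \<Rightarrow> ((real \<Rightarrow> real) \<times> real) measure \<Rightarrow> bool" where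
  "invariant_measure P \<phi> \<mu> \<longleftrightarrow>
     prob_space \<mu> \<and> sets \<mu> = sets (P \<Otimes>\<^sub>M borel) \<and> distr \<mu> P fst = P \<and>
     (\<forall>t\<ge>0. distr \<mu> \<mu> (skew_product \<phi> t) = \<mu>)"

definition is_disintegration ::
    "(real \<Rightarrow> real) measure \<Rightarrow> ((real \<Rightarrow> real) \<times> real) measure
      \<Rightarrow> ((real \<Rightarrow> real) \<Rightarrow> real measure) \<Rightarrow> bool" where
  "is_disintegration P \<mu> K \<longleftrightarrow>
     K \<in> measurable P (prob_algebra borel) \<and>
     (\<forall>E \<in> sets (P \<Otimes>\<^sub>M borel). emeasure \<mu> E = (\<integral>\<^sup>+ \<omega>. emeasure (K \<omega>) (Pair \<omega> -` E) \<partial>P))"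

definition markov_measure ::
    "(real \<Rightarrow> real) measure \<Rightarrow> cocycle \<Rightarrow> ((real \<Rightarrow> real) \<times> real) measure \<Rightarrow> bool" where
  "markov_measure P \<phi> \<mu> \<longleftrightarrow>
     invariant_measure P \<phi> \<mu> \<and>
     (\<exists>K. is_disintegration P \<mu> K \<and>
        (\<exists>K' \<in> measurable past (prob_algebra borel). AE \<omega> in P. K \<omega> = K' \<omega>))"

end

theory Submission
  imports Defs
begin

text \<open>Since the drift is one-sided Lipschitz and cubic, the pathwise flow is monotone in its initial
  value and comes down from infinity in finite time. The pullback limits of the flow started at
  \<open>+\<infinity>\<close> and \<open>-\<infinity>\<close> therefore exist for every path; they are equivariant and measurable with respect to
  the past. That they coincide almost surely follows from a splitting argument for monotone maps:
  an independent piece of noise pushes all solutions below \<open>0\<close> with positive probability, and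
  another one pushes all solutions above \<open>0\<close>; hence the largest probability that the two limits
  straddle a level is contracted by a factor less than \<open>1\<close> and must vanish. The only property of
  the noise this needs is that its increments are unbounded on both sides; otherwise, by divisibility, all
  increments over short times would be nearly of one sign, and there would be no jumps of the other sign.
  Finally, invariance forces every invariant measure to be carried by the region between the two
  flows at all times, hence by the graph of the limit.\<close>

section \<open>Comparison for the cubic equation\<close>

text \<open>The quantity that contracts is the supremum over all levels c of the probability of
  \<open>straddle c\<close>. A single level would not do: pulling c back through the flow over [0,t]
  gives a random level. That level depends on the future noise, the two limits on the past, so with
  the future frozen the supremum bounds the probability. Levels c \<ge> 0 have no such pullback once
  everything is pushed below 0, levels c < 0 once everything is pushed above 0. Both pushes must be
  complete at a deterministic time.

  Unboundedness only says that the value of the noise at time 1 passes any bound with positive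
  probability; the shape of the path before that is unknown. The push therefore shows, path by path
  and by contradiction, that 0 is crossed at some rational time, and countable additivity then
  selects one time of positive probability.

  Since paths jump, solutions are never differentiated: comparison is done on integral equations,
  where additive noise cancels from differences. The drift is odd, so x to -x turns statements about
  the flow from +\<infinity> into those about -\<infinity>, with -\<sigma> for \<sigma>.\<close>

lemma gronwall_nonpos:
  fixes u :: "real \<Rightarrow> real"
  assumes "a \<le> b" "0 \<le> C" and cont: "continuous_on {a..b} u" and "u a \<le> 0"
    and step: "\<And>s t. a \<le> s \<Longrightarrow> s \<le> t \<Longrightarrow> t \<le> b \<Longrightarrow> (\<And>r. r \<in> {s..t} \<Longrightarrow> 0 \<le> u r)
                 \<Longrightarrow> u t - u s \<le> C * integral {s..t} u"
  shows "u b \<le> 0"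
proof (rule ccontr)
  assume "\<not> u b \<le> 0"
  define Z where "Z = {r \<in> {a..b}. u r \<le> 0}"
  \<comment> \<open>The last time at which u is nonpositive. By continuity u vanishes there, and u
    is positive afterwards.\<close>
  define s where "s = Sup Z"
  have Z: "a \<in> Z" "closed Z" "bdd_above Z"
    using assms continuous_closed_preimage[OF cont, of "{..0}"]
    by (auto simp: Z_def bdd_above_def vimage_def Int_def)
  have "s \<in> Z"
    unfolding s_def using Z by (intro closed_contains_Sup) auto
  then have s: "a \<le> s" "s \<le> b" "u s \<le> 0"
    by (auto simp: Z_def)
  have Zs: "r \<le> s" if "r \<in> {a..b}" "u r \<le> 0" for r
    unfolding s_def using that Z by (intro cSup_upper) (auto simp: Z_def)
  obtain r where "s \<le> r" "r \<le> b" "u r = 0"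
    using IVT'[of u s 0 b] s \<open>\<not> u b \<le> 0\<close> continuous_on_subset[OF cont, of "{s..b}"] by auto
  with Zs[of r] s have us: "u s = 0" by auto
  have "s < b" using s \<open>\<not> u b \<le> 0\<close> by (cases "s = b") auto
  \<comment> \<open>The interval [s,c] is so short that C (c - s) \<le> 1/2. At a maximum point r of
    u on it, \<open>step\<close> then bounds u r by at most half of itself.\<close>
  define c where "c = min b (s + 1 / (2 * (C + 1)))"
  have c: "s < c" "c \<le> b" "c - s \<le> 1 / (2 * (C + 1))"
    using \<open>s < b\<close> \<open>0 \<le> C\<close> by (auto simp: c_def)
  obtain r where r: "r \<in> {s..c}" and max: "\<And>q. q \<in> {s..c} \<Longrightarrow> u q \<le> u r"
    using continuous_attains_sup[of "{s..c}" u] c s continuous_on_subset[OF cont, of "{s..c}"]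
    by auto
  have "u c > 0" using Zs[of c] c s by (force simp: not_le)
  then have ur: "u r > 0" using max[of c] c by auto
  have int: "u integrable_on {s..r}"
    using r c s by (intro integrable_continuous_interval continuous_on_subset[OF cont]) auto
  have "integral {s..r} u \<le> integral {s..r} (\<lambda>_. u r)"
    using max r by (intro integral_le int) auto
  also have "\<dots> = u r * (r - s)" using r by simp
  also have "\<dots> \<le> u r * (1 / (2 * (C + 1)))"
    using ur r c by (intro mult_left_mono) auto
  finally have I: "integral {s..r} u \<le> u r * (1 / (2 * (C + 1)))" .
  have "0 \<le> u q" if "q \<in> {s..r}" for q
    using Zs[of q] that r c s us by (cases "q = s") (auto simp: not_le intro: ccontr)
  then have "u r - u s \<le> C * integral {s..r} u"
    using r c s by (intro step) auto
  also have "\<dots> \<le> C * (u r * (1 / (2 * (C + 1))))"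
    using I \<open>0 \<le> C\<close> by (rule mult_left_mono)
  also have "\<dots> = u r * (C / (2 * (C + 1)))" by simp
  also have "\<dots> < u r * 1"
    using ur \<open>0 \<le> C\<close> by (intro mult_strict_left_mono) (auto simp: field_simps)
  finally show False using us by simp
qed

lemma has_integral_increment:
  fixes f :: "real \<Rightarrow> real"
  assumes s: "(f has_integral F s) {a..s}" and t: "(f has_integral F t) {a..t}" and "a \<le> s" "s \<le> t"
  shows "(f has_integral (F t - F s)) {s..t}"
proof -
  have int: "f integrable_on {a..t}" using t by (rule has_integral_integrable)
  then have "f integrable_on {s..t}"
    by (rule integrable_on_subinterval) (use \<open>a \<le> s\<close> in simp)
  moreover have "integral {a..s} f + integral {s..t} f = integral {a..t} f"
    by (rule Henstock_Kurzweil_Integration.integral_combine[OF \<open>a \<le> s\<close> \<open>s \<le> t\<close> int])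
  ultimately show ?thesis
    using integral_unique[OF s] integral_unique[OF t] by (simp add: has_integral_iff)
qed

lemma has_integral_continuous_on:
  fixes f :: "real \<Rightarrow> real"
  assumes "\<And>t. t \<in> {a..b} \<Longrightarrow> (f has_integral F t) {a..t}"
  shows "continuous_on {a..b} F"
proof (cases "a \<le> b")
  case True
  have "continuous_on {a..b} (\<lambda>t. integral {a..t} f)"
    using assms[of b] True by (intro indefinite_integral_continuous_1) auto
  then show ?thesis
    by (rule continuous_on_eq) (simp add: integral_unique[OF assms])
qed auto

text \<open>The cubic part only helps: y^3 - x^3 = (y - x)(x^2 + xy + y^2) with a nonnegative second
  factor. The constant is |\<beta>| rather than \<beta> because \<open>gronwall_nonpos\<close> asks
  for a nonnegative one.\<close>

lemma cubic_one_sided_lipschitz: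
  fixes x y \<beta> :: real
  assumes "x \<le> y"
  shows "(\<beta> * y - y ^ 3) - (\<beta> * x - x ^ 3) \<le> \<bar>\<beta>\<bar> * (y - x)"
proof -
  have "0 \<le> x\<^sup>2 + x * y + y\<^sup>2"
  proof -
    have "x\<^sup>2 + x * y + y\<^sup>2 = ((x + y)\<^sup>2 + x\<^sup>2 + y\<^sup>2) / 2"
      by (simp add: power2_sum)
    moreover have "0 \<le> ((x + y)\<^sup>2 + x\<^sup>2 + y\<^sup>2) / 2" by simp
    ultimately show ?thesis by linarith
  qed
  then have "(y - x) * (\<beta> - (x\<^sup>2 + x * y + y\<^sup>2)) \<le> (y - x) * \<bar>\<beta>\<bar>"
    using assms by (intro mult_left_mono) auto
  moreover have "(\<beta> * y - y ^ 3) - (\<beta> * x - x ^ 3) = (y - x) * (\<beta> - (x\<^sup>2 + x * y + y\<^sup>2))"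
    by (simp add: power2_eq_square power3_eq_cube algebra_simps)
  ultimately show ?thesis by (simp add: mult.commute)
qed

text \<open>The driving term w cancels in Y - X, which is therefore continuous even where X and Y
  jump. Applying \<open>gronwall_nonpos\<close> to X - Y gives the order; knowing the order, a
  second application gives the exponential bound.\<close>

lemma cubic_comparison:
  fixes X Y w :: "real \<Rightarrow> real"
  assumes X: "\<And>t. t \<in> {0..T} \<Longrightarrow> ((\<lambda>s. \<beta> * X s - X s ^ 3) has_integral (X t - x - w t)) {0..t}"
    and Y: "\<And>t. t \<in> {0..T} \<Longrightarrow> ((\<lambda>s. \<beta> * Y s - Y s ^ 3) has_integral (Y t - y - w t)) {0..t}"
    and "x \<le> y" "0 \<le> T"
  shows "X T \<le> Y T" and "Y T - X T \<le> (y - x) * exp (\<bar>\<beta>\<bar> * T)"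
proof -
  let ?b = "\<lambda>z. \<beta> * z - z ^ 3"
  have D: "((\<lambda>s. ?b (Y s) - ?b (X s)) has_integral (Y t - X t - (y - x))) {0..t}"
    if "t \<in> {0..T}" for t
    using has_integral_diff[OF Y[OF that] X[OF that]] by (simp add: algebra_simps)
  have inc: "((\<lambda>s. ?b (Y s) - ?b (X s)) has_integral (Y t - X t) - (Y s - X s)) {s..t}"
    if "0 \<le> s" "s \<le> t" "t \<le> T" for s t
    using has_integral_increment[OF D[of s] D[of t]] that by (simp add: algebra_simps)
  have cont: "continuous_on {0..T} (\<lambda>t. Y t - X t)"
    using continuous_on_add[OF has_integral_continuous_on[OF D] continuous_on_const[of _ "y - x"]]
    by simp
  \<comment> \<open>w 0 is arbitrary. The equation over the degenerate interval {0..0} identifies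
    the initial values, whose difference is y - x in any case.\<close>
  have init: "X 0 = x + w 0" "Y 0 = y + w 0"
  proof -
    show "X 0 = x + w 0"
      using has_integral_unique[OF X[of 0, simplified] has_integral_refl(2)] \<open>0 \<le> T\<close> by simp
    show "Y 0 = y + w 0"
      using has_integral_unique[OF Y[of 0, simplified] has_integral_refl(2)] \<open>0 \<le> T\<close> by simp
  qed
  have int: "(\<lambda>t. Y t - X t) integrable_on {s..t}" if "0 \<le> s" "t \<le> T" for s t
    using that by (intro integrable_continuous_interval continuous_on_subset[OF cont]) auto
  have up: "Y t - X t - (Y s - X s) \<le> \<bar>\<beta>\<bar> * integral {s..t} (\<lambda>r. Y r - X r)"
    if "0 \<le> s" "s \<le> t" "t \<le> T" "\<And>r. r \<in> {s..t} \<Longrightarrow> X r \<le> Y r" for s t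
  proof (rule has_integral_le[OF inc])
    show "((\<lambda>r. \<bar>\<beta>\<bar> * (Y r - X r)) has_integral \<bar>\<beta>\<bar> * integral {s..t} (\<lambda>r. Y r - X r)) {s..t}"
      using that by (intro has_integral_mult_right integrable_integral int) auto
    show "?b (Y r) - ?b (X r) \<le> \<bar>\<beta>\<bar> * (Y r - X r)" if "r \<in> {s..t}" for r
      using that \<open>\<And>r. r \<in> {s..t} \<Longrightarrow> X r \<le> Y r\<close> by (intro cubic_one_sided_lipschitz) auto
  qed (use that in auto)
  \<comment> \<open>The one-sided bound controls the growth of X - Y only where X \<ge> Y, which is
    exactly what \<open>gronwall_nonpos\<close> allows to be assumed in its \<open>step\<close>
    hypothesis.\<close>
  have le: "X t - Y t \<le> 0" if "t \<in> {0..T}" for t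
  proof (rule gronwall_nonpos[of 0 t "\<bar>\<beta>\<bar>" "\<lambda>t. X t - Y t"])
    show "continuous_on {0..t} (\<lambda>t. X t - Y t)"
      using continuous_on_minus[OF continuous_on_subset[OF cont, of "{0..t}"]] that by simp
    fix s r assume sr: "0 \<le> s" "s \<le> r" "r \<le> t" and pos: "\<And>q. q \<in> {s..r} \<Longrightarrow> 0 \<le> X q - Y q"
    have "Y s - X s - (Y r - X r) \<le> \<bar>\<beta>\<bar> * integral {s..r} (\<lambda>r. X r - Y r)"
    proof (rule has_integral_le)
      show "((\<lambda>s. ?b (X s) - ?b (Y s)) has_integral (Y s - X s) - (Y r - X r)) {s..r}"
        using has_integral_neg[OF inc[of s r]] sr that by simp
      have "(\<lambda>r. X r - Y r) integrable_on {s..r}"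
        using integrable_neg[OF int[of s r]] sr that by simp
      then show "((\<lambda>r. \<bar>\<beta>\<bar> * (X r - Y r)) has_integral \<bar>\<beta>\<bar> * integral {s..r} (\<lambda>r. X r - Y r)) {s..r}"
        by (intro has_integral_mult_right integrable_integral)
      show "?b (X q) - ?b (Y q) \<le> \<bar>\<beta>\<bar> * (X q - Y q)" if "q \<in> {s..r}" for q
        using pos[OF that] by (intro cubic_one_sided_lipschitz) auto
    qed
    then show "X r - Y r - (X s - Y s) \<le> \<bar>\<beta>\<bar> * integral {s..r} (\<lambda>r. X r - Y r)" by simp
  qed (use that init \<open>x \<le> y\<close> in auto)
  from le[of T] \<open>0 \<le> T\<close> show "X T \<le> Y T" by simp
  \<comment> \<open>The exponential satisfies the integral inequality with equality, so subtracting
    it leaves an inequality of the same form with initial value 0.\<close>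
  let ?e = "\<lambda>t. (y - x) * exp (\<bar>\<beta>\<bar> * t)"
  have "Y T - X T - ?e T \<le> 0"
  proof (rule gronwall_nonpos[of 0 T "\<bar>\<beta>\<bar>" "\<lambda>t. Y t - X t - ?e t"])
    show "continuous_on {0..T} (\<lambda>t. Y t - X t - ?e t)"
      by (intro continuous_intros cont)
    fix s t assume st: "0 \<le> s" "s \<le> t" "t \<le> T"
    have e: "((\<lambda>t. \<bar>\<beta>\<bar> * ?e t) has_integral (?e t - ?e s)) {s..t}"
      using st by (intro fundamental_theorem_of_calculus)
        (auto intro!: derivative_eq_intros simp flip: has_real_derivative_iff_has_vector_derivative)
    have eint: "?e integrable_on {s..t}"
      by (intro integrable_continuous_interval continuous_intros)
    have "Y t - X t - (Y s - X s) \<le> \<bar>\<beta>\<bar> * integral {s..t} (\<lambda>r. Y r - X r)"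
      using le st by (intro up) auto
    moreover have "\<bar>\<beta>\<bar> * integral {s..t} ?e = ?e t - ?e s"
      using integral_unique[OF e] by simp
    ultimately show "Y t - X t - ?e t - (Y s - X s - ?e s)
        \<le> \<bar>\<beta>\<bar> * integral {s..t} (\<lambda>t. Y t - X t - ?e t)"
      using Henstock_Kurzweil_Integration.integral_diff[OF int[of s t] eint] st
      by (simp add: right_diff_distrib)
  qed (use init \<open>0 \<le> T\<close> in auto)
  then show "Y T - X T \<le> ?e T" by simp
qed

text \<open>The bound is free of x. The barrier K + |\<beta>| + 1 + 1/t for X - w contains the
  solution 1/t of z' = -z^2 that starts at infinity: where X - w is above the barrier, X \<ge>
  |\<beta>| + 1 + 1/t, and there the drift is at most -X^2 \<le> -1/t^2, the slope of the
  barrier.\<close>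

lemma cubic_coming_down:
  fixes X w :: "real \<Rightarrow> real"
  assumes X: "\<And>t. t \<in> {0..T} \<Longrightarrow> ((\<lambda>s. \<beta> * X s - X s ^ 3) has_integral (X t - x - w t)) {0..t}"
    and w: "\<And>t. t \<in> {0..T} \<Longrightarrow> \<bar>w t\<bar> \<le> K" and "0 < T"
  shows "X T \<le> 2 * K + \<bar>\<beta>\<bar> + 1 + 1 / T"
proof -
  let ?g = "\<lambda>t. K + \<bar>\<beta>\<bar> + 1 + 1 / t"
  have contY: "continuous_on {0..T} (\<lambda>t. X t - w t)"
    using continuous_on_add[OF has_integral_continuous_on[OF X] continuous_on_const[of _ x]]
    by simp
  have inc: "((\<lambda>s. \<beta> * X s - X s ^ 3) has_integral (X t - w t) - (X s - w s)) {s..t}"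
    if "0 \<le> s" "s \<le> t" "t \<le> T" for s t
    using has_integral_increment[OF X[of s] X[of t]] that by (simp add: algebra_simps)
  obtain B where B: "\<And>t. t \<in> {0..T} \<Longrightarrow> X t - w t \<le> B"
    using continuous_attains_sup[of "{0..T}" "\<lambda>t. X t - w t"] contY \<open>0 < T\<close>
    by (force simp: Ball_def)
  \<comment> \<open>The barrier is infinite at time 0, so the comparison starts at a positive time
    so small that 1/\<epsilon> exceeds the maximum of X - w.\<close>
  define \<epsilon> where "\<epsilon> = min T (1 / (\<bar>B\<bar> + 1))"
  have \<epsilon>: "0 < \<epsilon>" "\<epsilon> \<le> T" "B \<le> 1 / \<epsilon>"
  proof -
    show "0 < \<epsilon>" "\<epsilon> \<le> T" using \<open>0 < T\<close> by (auto simp: \<epsilon>_def)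
    have "1 / (1 / (\<bar>B\<bar> + 1)) \<le> 1 / \<epsilon>"
      using \<open>0 < \<epsilon>\<close> by (intro divide_left_mono) (auto simp: \<epsilon>_def)
    then show "B \<le> 1 / \<epsilon>" by auto
  qed
  have "0 \<le> K" using w[of 0] \<open>0 < T\<close> by auto
  have "X T - w T - ?g T \<le> 0"
  proof (rule gronwall_nonpos[of \<epsilon> T 0 "\<lambda>t. X t - w t - ?g t"])
    show "continuous_on {\<epsilon>..T} (\<lambda>t. X t - w t - ?g t)"
      using \<epsilon> by (intro continuous_intros continuous_on_subset[OF contY]) auto
    show "X \<epsilon> - w \<epsilon> - ?g \<epsilon> \<le> 0"
      using B[of \<epsilon>] \<epsilon> \<open>0 \<le> K\<close> by auto
    fix s t assume st: "\<epsilon> \<le> s" "s \<le> t" "t \<le> T" and pos: "\<And>r. r \<in> {s..t} \<Longrightarrow> 0 \<le> X r - w r - ?g r"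
    have "(X t - w t) - (X s - w s) \<le> 1 / t - 1 / s"
    proof (rule has_integral_le[OF inc])
      show "((\<lambda>r. - 1 / r\<^sup>2) has_integral (1 / t - 1 / s)) {s..t}"
        using st \<epsilon> by (intro fundamental_theorem_of_calculus)
          (auto intro!: derivative_eq_intros simp: power2_eq_square
             simp flip: has_real_derivative_iff_has_vector_derivative)
      fix r assume r: "r \<in> {s..t}"
      define z where "z = X r"
      have "r > 0" using r st \<epsilon> by auto
      have z: "\<bar>\<beta>\<bar> + 1 + 1 / r \<le> z"
        using pos[OF r] w[of r] r st \<epsilon> by (auto simp: z_def)
      then have z1: "\<bar>\<beta>\<bar> + 1 \<le> z" "1 / r \<le> z" "0 \<le> z"
        using \<open>r > 0\<close> by (smt (verit) divide_nonneg_pos)+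
      \<comment> \<open>Beyond |\<beta>| + 1 one has z (z - 1) \<ge> \<beta>; multiplied by z this
        is \<beta> z - z^3 \<le> -z^2.\<close>
      have "(\<bar>\<beta>\<bar> + 1) * \<bar>\<beta>\<bar> \<le> z * (z - 1)"
        using z1 by (intro mult_mono) auto
      moreover have "(\<bar>\<beta>\<bar> + 1) * \<bar>\<beta>\<bar> \<ge> \<beta>" 
        by (smt (verit) mult_le_cancel_right1 mult_nonneg_nonneg)
      ultimately have "z * (\<beta> + z - z * z) \<le> 0"
        using z1 by (intro mult_nonneg_nonpos) (auto simp: algebra_simps)
      then have "\<beta> * z - z ^ 3 \<le> - (z ^ 2)"
        by (simp add: power2_eq_square power3_eq_cube algebra_simps)
      also have "\<dots> \<le> - ((1 / r) ^ 2)"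
        using z1 \<open>r > 0\<close> power_mono[of "1 / r" z 2] by simp
      finally show "\<beta> * X r - X r ^ 3 \<le> - 1 / r\<^sup>2"
        by (simp add: z_def power_divide)
    qed (use st \<epsilon> in auto)
    then show "X t - w t - ?g t - (X s - w s - ?g s) \<le> 0 * integral {s..t} (\<lambda>t. X t - w t - ?g t)"
      by simp
  qed (use \<epsilon> in auto)
  then show ?thesis using w[of T] \<open>0 < T\<close> by auto
qed

section \<open>Path space\<close>

lemma cadlag_shift:
  assumes "cadlag \<omega>"
  shows "cadlag (shift t \<omega>)"
proof -
  have r: "filterlim (\<lambda>s. t + s) (at_right (t + u)) (at_right u)" for u
    unfolding filterlim_at
    by (auto intro!: tendsto_intros simp: eventually_at_filter)
  have l: "filterlim (\<lambda>s. t + s) (at_left (t + u)) (at_left u)" for u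
    unfolding filterlim_at
    by (auto intro!: tendsto_intros simp: eventually_at_filter)
  show ?thesis
    unfolding cadlag_def shift_def
  proof (intro allI conjI)
    fix u
    show "((\<lambda>s. \<omega> (t + s) - \<omega> t) \<longlongrightarrow> \<omega> (t + u) - \<omega> t) (at_right u)"
      using assms filterlim_compose[OF _ r[of u], of \<omega>] by (intro tendsto_intros) (auto simp: cadlag_def)
    obtain m where "(\<omega> \<longlongrightarrow> m) (at_left (t + u))"
      using assms by (auto simp: cadlag_def)
    then have "((\<lambda>s. \<omega> (t + s) - \<omega> t) \<longlongrightarrow> m - \<omega> t) (at_left u)"
      using filterlim_compose[OF _ l[of u], of \<omega>] by (intro tendsto_intros) auto
    then show "\<exists>m. ((\<lambda>s. \<omega> (t + s) - \<omega> t) \<longlongrightarrow> m) (at_left u)" ..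
  qed
qed

lemma shift_paths [simp]: "\<omega> \<in> paths \<Longrightarrow> shift t \<omega> \<in> paths"
  using cadlag_shift by (auto simp: paths_def shift_def)

lemma shift_shift: "shift s (shift t \<omega>) = shift (t + s) \<omega>"
  by (auto simp: shift_def add.assoc)

lemma shift_0 [simp]: "\<omega> \<in> paths \<Longrightarrow> shift 0 \<omega> = \<omega>"
  by (auto simp: shift_def paths_def)

lemma shift_neg_shift [simp]: "\<omega> \<in> paths \<Longrightarrow> shift (- t) (shift t \<omega>) = \<omega>"
  "\<omega> \<in> paths \<Longrightarrow> shift t (shift (- t) \<omega>) = \<omega>"
  by (simp_all add: shift_shift)

definition past_part :: "(real \<Rightarrow> real) \<Rightarrow> real \<Rightarrow> real" where
  "past_part \<omega> = (\<lambda>s. \<omega> (min s 0))"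

definition future_part :: "(real \<Rightarrow> real) \<Rightarrow> real \<Rightarrow> real" where
  "future_part \<omega> = (\<lambda>s. \<omega> (max s 0))"

lemma past_part_paths [simp]:
  assumes "\<omega> \<in> paths"
  shows "past_part \<omega> \<in> paths"
proof -
  have R: "(\<omega> \<longlongrightarrow> \<omega> t) (at_right t)" and L: "\<exists>l. (\<omega> \<longlongrightarrow> l) (at_left t)" for t
    using assms by (auto simp: paths_def cadlag_def)
  have "(past_part \<omega> \<longlongrightarrow> past_part \<omega> t) (at_right t)" for t
  proof (cases "t < 0")
    case True
    then have "\<forall>\<^sub>F s in at_right t. \<omega> s = past_part \<omega> s"
      by (auto simp: eventually_at_right past_part_def intro!: exI[of _ 0])
    with R[of t] show ?thesis using True
      by (auto simp: past_part_def elim: Lim_transform_eventually)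
  next
    case False
    then have "\<forall>\<^sub>F s in at_right t. past_part \<omega> t = past_part \<omega> s"
      by (auto simp: eventually_at_right[of t "t + 1"] past_part_def intro!: exI[of _ "t + 1"])
    then show ?thesis by (rule Lim_transform_eventually[OF tendsto_const])
  qed
  moreover have "\<exists>l. (past_part \<omega> \<longlongrightarrow> l) (at_left t)" for t
  proof (cases "t \<le> 0")
    case True
    then have "\<forall>\<^sub>F s in at_left t. \<omega> s = past_part \<omega> s"
      by (auto simp: eventually_at_left[of "t - 1" t] past_part_def intro!: exI[of _ "t - 1"])
    with L[of t] show ?thesis by (auto elim: Lim_transform_eventually)
  next
    case False
    then have "\<forall>\<^sub>F s in at_left t. \<omega> 0 = past_part \<omega> s"
      by (auto simp: eventually_at_left[of 0 t] past_part_def intro!: exI[of _ 0])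
    then show ?thesis by (auto intro: Lim_transform_eventually[OF tendsto_const])
  qed
  ultimately show ?thesis
    using assms by (auto simp: paths_def cadlag_def past_part_def)
qed

lemma future_part_paths [simp]:
  assumes "\<omega> \<in> paths"
  shows "future_part \<omega> \<in> paths"
proof -
  have R: "(\<omega> \<longlongrightarrow> \<omega> t) (at_right t)" and L: "\<exists>l. (\<omega> \<longlongrightarrow> l) (at_left t)" for t
    using assms by (auto simp: paths_def cadlag_def)
  have "(future_part \<omega> \<longlongrightarrow> future_part \<omega> t) (at_right t)" for t
  proof (cases "t < 0")
    case True
    then have "\<forall>\<^sub>F s in at_right t. future_part \<omega> t = future_part \<omega> s"
      by (auto simp: eventually_at_right future_part_def intro!: exI[of _ 0])
    then show ?thesis by (rule Lim_transform_eventually[OF tendsto_const])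
  next
    case False
    then have "\<forall>\<^sub>F s in at_right t. \<omega> s = future_part \<omega> s"
      by (auto simp: eventually_at_right[of t "t + 1"] future_part_def intro!: exI[of _ "t + 1"])
    with R[of t] show ?thesis using False
      by (auto simp: future_part_def elim: Lim_transform_eventually)
  qed
  moreover have "\<exists>l. (future_part \<omega> \<longlongrightarrow> l) (at_left t)" for t
  proof (cases "t \<le> 0")
    case True
    then have "\<forall>\<^sub>F s in at_left t. \<omega> 0 = future_part \<omega> s"
      by (auto simp: eventually_at_left[of "t - 1" t] future_part_def intro!: exI[of _ "t - 1"])
    then show ?thesis by (auto intro: Lim_transform_eventually[OF tendsto_const])
  next
    case False
    then have "\<forall>\<^sub>F s in at_left t. \<omega> s = future_part \<omega> s"
      by (auto simp: eventually_at_left[of 0 t] future_part_def intro!: exI[of _ 0])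
    with L[of t] show ?thesis by (auto elim: Lim_transform_eventually)
  qed
  ultimately show ?thesis
    using assms by (auto simp: paths_def cadlag_def future_part_def)
qed

text \<open>One-sided limits bound the path near each point, with the value at the point taken
  separately; Bolzano's bisection principle glues the local bounds.\<close>

lemma cadlag_bounded:
  assumes "cadlag \<omega>" "a \<le> b"
  shows "\<exists>K. \<forall>t\<in>{a..b}. \<bar>\<omega> t\<bar> \<le> K"
  using \<open>a \<le> b\<close>
proof (induction rule: Bolzano)
  case (trans a b c)
  then obtain K1 K2 where K: "\<forall>t\<in>{a..b}. \<bar>\<omega> t\<bar> \<le> K1" "\<forall>t\<in>{b..c}. \<bar>\<omega> t\<bar> \<le> K2" by blast
  have "\<bar>\<omega> t\<bar> \<le> max K1 K2" if "t \<in> {a..c}" for t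
    using K that by (cases "t \<le> b") (auto simp: le_max_iff_disj)
  then show ?case by blast
next
  case (local x)
  obtain l where l: "(\<omega> \<longlongrightarrow> l) (at_left x)" and r: "(\<omega> \<longlongrightarrow> \<omega> x) (at_right x)"
    using assms(1) by (auto simp: cadlag_def)
  obtain d1 where d1: "d1 < x" "\<And>t. d1 < t \<Longrightarrow> t < x \<Longrightarrow> dist (\<omega> t) l < 1"
    using tendstoD[OF l, of 1] by (auto simp: eventually_at_left[of "x - 1"])
  obtain d2 where d2: "d2 > x" "\<And>t. d2 > t \<Longrightarrow> t > x \<Longrightarrow> dist (\<omega> t) (\<omega> x) < 1"
    using tendstoD[OF r, of 1] by (auto simp: eventually_at_right[of _ "x + 1"])
  have "\<bar>\<omega> t\<bar> \<le> \<bar>l\<bar> + \<bar>\<omega> x\<bar> + 1" if "d1 < t" "t < d2" for t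
    using d1(2)[of t] d2(2)[of t] that by (cases t x rule: linorder_cases) (auto simp: dist_real_def)
  then have "\<forall>a b. a \<le> x \<and> x \<le> b \<and> b - a < min (x - d1) (d2 - x)
      \<longrightarrow> (\<forall>t\<in>{a..b}. \<bar>\<omega> t\<bar> \<le> \<bar>l\<bar> + \<bar>\<omega> x\<bar> + 1)"
    by auto
  moreover have "0 < min (x - d1) (d2 - x)" using d1 d2 by auto
  ultimately show ?case by blast
qed

lemma space_path_space [simp]: "space path_space = paths"
  by (simp add: path_space_def space_restrict_space space_PiM)

lemma measurable_eval [measurable]: "(\<lambda>\<omega>. \<omega> t) \<in> borel_measurable path_space"
  unfolding path_space_def by (intro measurable_restrict_space1 measurable_component_singleton) simp

lemma measurable_into_path_space:
  assumes "\<And>x. x \<in> space M \<Longrightarrow> f x \<in> paths" "\<And>t. (\<lambda>x. f x t) \<in> borel_measurable M"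
  shows "f \<in> measurable M path_space"
  unfolding path_space_def
proof (rule measurable_restrict_space2)
  show "f \<in> measurable M (Pi\<^sub>M UNIV (\<lambda>_. borel))"
    using measurable_restrict[of UNIV "\<lambda>t x. f x t" M "\<lambda>_. borel"] assms(2)
    by (simp add: restrict_UNIV)
qed (use assms(1) in auto)

lemma measurable_shift [measurable]: "shift t \<in> measurable path_space path_space"
  by (rule measurable_into_path_space, simp) (simp add: shift_def)

lemma measurable_past_part [measurable]: "past_part \<in> measurable path_space path_space"
  by (rule measurable_into_path_space, simp) (simp add: past_part_def)

lemma measurable_future_part [measurable]: "future_part \<in> measurable path_space path_space"
  by (rule measurable_into_path_space, simp) (simp add: future_part_def)

lemma space_past [simp]: "space past = paths"
  unfolding past_def by (intro space_measure_of) auto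

text \<open>The bridge to the Markov property: composed with this map, every measurable functional
  that is unchanged by \<open>past_part\<close> becomes measurable with respect to
  \<open>past\<close>.\<close>

lemma measurable_past_part_past: "past_part \<in> measurable past path_space"
proof (rule measurable_into_path_space)
  fix t :: real
  show "(\<lambda>\<omega>. past_part \<omega> t) \<in> borel_measurable past"
  proof (rule measurableI)
    fix B :: "real set" assume "B \<in> sets borel"
    then have "{\<omega> \<in> paths. \<omega> (min t 0) \<in> B} \<in> sets past"
      unfolding past_def by (subst sets_measure_of) (auto intro!: sigma_sets.Basic exI[of _ "min t 0"])
    then show "(\<lambda>\<omega>. past_part \<omega> t) -` B \<inter> space past \<in> sets past"
      by (simp add: past_part_def vimage_def Int_def conj_commute)
  qed simp
qed simp

section \<open>The pathwise flow and its pullback limits\<close>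

locale cubic_flow =
  fixes \<beta> \<sigma> :: real and \<phi> :: cocycle
  assumes generated: "generated_by_sde (\<lambda>x. \<beta> * x - x ^ 3) \<sigma> \<phi>"
begin

lemma solution:
  assumes "\<omega> \<in> paths" "0 \<le> t"
  shows "((\<lambda>s. \<beta> * \<phi> s \<omega> x - \<phi> s \<omega> x ^ 3) has_integral (\<phi> t \<omega> x - x - \<sigma> * \<omega> t)) {0..t}"
  using generated assms by (auto simp: generated_by_sde_def)

lemma cocycle:
  assumes "\<omega> \<in> paths" "0 \<le> s" "0 \<le> t"
  shows "\<phi> (s + t) \<omega> x = \<phi> t (shift s \<omega>) (\<phi> s \<omega> x)"
  using generated assms by (auto simp: generated_by_sde_def random_dynamical_system_def)

lemma initial: "\<omega> \<in> paths \<Longrightarrow> \<phi> 0 \<omega> x = x"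
  using generated by (auto simp: generated_by_sde_def random_dynamical_system_def)

lemma mono_flow:
  assumes "\<omega> \<in> paths" "0 \<le> t" "x \<le> y"
  shows "\<phi> t \<omega> x \<le> \<phi> t \<omega> y"
  by (rule cubic_comparison(1)[where X = "\<lambda>s. \<phi> s \<omega> x" and Y = "\<lambda>s. \<phi> s \<omega> y" and T = t
        and w = "\<lambda>s. \<sigma> * \<omega> s", OF solution solution])
    (use assms in auto)

lemma lipschitz_flow:
  assumes "\<omega> \<in> paths" "0 \<le> t"
  shows "\<bar>\<phi> t \<omega> x - \<phi> t \<omega> y\<bar> \<le> exp (\<bar>\<beta>\<bar> * t) * \<bar>x - y\<bar>"
proof -
  have "\<bar>\<phi> t \<omega> v - \<phi> t \<omega> u\<bar> \<le> exp (\<bar>\<beta>\<bar> * t) * \<bar>v - u\<bar>" if "u \<le> v" for u v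
  proof -
    have "\<phi> t \<omega> v - \<phi> t \<omega> u \<le> (v - u) * exp (\<bar>\<beta>\<bar> * t)"
      by (rule cubic_comparison(2)[where X = "\<lambda>s. \<phi> s \<omega> u" and Y = "\<lambda>s. \<phi> s \<omega> v" and T = t
            and w = "\<lambda>s. \<sigma> * \<omega> s", OF solution solution])
        (use assms that in auto)
    with mono_flow[OF assms that] that show ?thesis by (simp add: mult.commute)
  qed
  from this[of x y] this[of y x] show ?thesis
    by (cases "x \<le> y") (auto simp: abs_minus_commute)
qed

lemma continuous_flow:
  assumes "\<omega> \<in> paths" "0 \<le> t"
  shows "continuous_on UNIV (\<phi> t \<omega>)"
proof -
  have "(exp (\<bar>\<beta>\<bar> * t))-lipschitz_on UNIV (\<phi> t \<omega>)"
    using lipschitz_flow[OF assms] by (intro lipschitz_onI) (auto simp: dist_real_def)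
  then show ?thesis by (rule lipschitz_on_continuous_on)
qed

text \<open>Comparison in both directions gives uniqueness, and with it locality: only the driving
  path on [0,t] matters. The separation of past and future below rests on this.\<close>

lemma flow_cong:
  assumes "\<omega> \<in> paths" "\<omega>' \<in> paths" "0 \<le> t" and eq: "\<And>s. s \<in> {0..t} \<Longrightarrow> \<omega> s = \<omega>' s"
  shows "\<phi> t \<omega> x = \<phi> t \<omega>' x"
proof (rule antisym)
  have sol': "((\<lambda>s. \<beta> * \<phi> s \<omega>' x - \<phi> s \<omega>' x ^ 3) has_integral (\<phi> s \<omega>' x - x - \<sigma> * \<omega> s)) {0..s}"
    if "s \<in> {0..t}" for s
    using solution[of \<omega>' s x] assms that by simp
  show "\<phi> t \<omega> x \<le> \<phi> t \<omega>' x"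
    by (rule cubic_comparison(1)[where X = "\<lambda>s. \<phi> s \<omega> x" and Y = "\<lambda>s. \<phi> s \<omega>' x" and T = t
          and w = "\<lambda>s. \<sigma> * \<omega> s", OF solution sol'])
      (use assms in auto)
  show "\<phi> t \<omega>' x \<le> \<phi> t \<omega> x"
    by (rule cubic_comparison(1)[where X = "\<lambda>s. \<phi> s \<omega>' x" and Y = "\<lambda>s. \<phi> s \<omega> x" and T = t
          and w = "\<lambda>s. \<sigma> * \<omega> s", OF sol' solution])
      (use assms in auto)
qed

lemma coming_down:
  assumes "\<omega> \<in> paths" "0 < t"
  shows "\<exists>R. \<forall>x. \<phi> t \<omega> x \<le> R"
proof -
  obtain K where K: "\<forall>s\<in>{0..t}. \<bar>\<omega> s\<bar> \<le> K"
    using cadlag_bounded[of \<omega> 0 t] assms by (auto simp: paths_def)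
  have "\<phi> t \<omega> x \<le> 2 * (\<bar>\<sigma>\<bar> * K) + \<bar>\<beta>\<bar> + 1 + 1 / t" for x
  proof (rule cubic_coming_down[where X = "\<lambda>t. \<phi> t \<omega> x" and w = "\<lambda>t. \<sigma> * \<omega> t"])
    show "\<bar>\<sigma> * \<omega> s\<bar> \<le> \<bar>\<sigma>\<bar> * K" if "s \<in> {0..t}" for s
      using K that by (auto simp: abs_mult intro: mult_left_mono)
  qed (use solution assms in auto)
  then show ?thesis by blast
qed

lemma measurable_flow:
  assumes "0 \<le> t"
  shows "(\<lambda>(\<omega>, x). \<phi> t \<omega> x) \<in> borel_measurable (path_space \<Otimes>\<^sub>M borel)"
proof -
  have joint: "(\<lambda>(t, \<omega>, x). \<phi> t \<omega> x)
      \<in> borel_measurable (restrict_space borel {0..} \<Otimes>\<^sub>M (path_space \<Otimes>\<^sub>M borel))"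
    using generated by (auto simp: generated_by_sde_def random_dynamical_system_def)
  have "(\<lambda>p. (t, p)) \<in> measurable (path_space \<Otimes>\<^sub>M borel) (restrict_space borel {0..} \<Otimes>\<^sub>M (path_space \<Otimes>\<^sub>M borel))"
    using assms by (intro measurable_Pair measurable_const measurable_ident) (auto simp: space_restrict_space)
  from measurable_compose[OF this joint] show ?thesis by (simp add: split_beta')
qed

lemma measurable_flow_compose [measurable (raw)]:
  assumes "f \<in> measurable M path_space" "g \<in> borel_measurable M" "0 \<le> t"
  shows "(\<lambda>x. \<phi> t (f x) (g x)) \<in> borel_measurable M"
  using measurable_compose[OF measurable_Pair[OF assms(1,2)] measurable_flow[OF assms(3)]] by simp

text \<open>The solution minus its noise term is an indefinite integral, hence continuous, and the
  noise is right-continuous. This lets a strict inequality at one time pass to a nearby rational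
  time.\<close>

lemma right_continuous_flow:
  assumes "\<omega> \<in> paths" "0 \<le> t"
  shows "((\<lambda>s. \<phi> s \<omega> x) \<longlongrightarrow> \<phi> t \<omega> x) (at_right t)"
proof -
  have "continuous_on {0..t + 1} (\<lambda>s. \<phi> s \<omega> x - x - \<sigma> * \<omega> s)"
    using solution[OF assms(1)] by (intro has_integral_continuous_on) auto
  then have "continuous_on {t..t + 1} (\<lambda>s. \<phi> s \<omega> x - x - \<sigma> * \<omega> s)"
    by (rule continuous_on_subset) (use assms in auto)
  then have "((\<lambda>s. \<phi> s \<omega> x - x - \<sigma> * \<omega> s) \<longlongrightarrow> \<phi> t \<omega> x - x - \<sigma> * \<omega> t) (at_right t)"
    by (auto simp: continuous_on at_within_Icc_at_right dest!: bspec[of _ _ t])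
  moreover have "((\<lambda>s. x + \<sigma> * \<omega> s) \<longlongrightarrow> x + \<sigma> * \<omega> t) (at_right t)"
    using assms by (intro tendsto_intros) (auto simp: paths_def cadlag_def)
  ultimately have "((\<lambda>s. (\<phi> s \<omega> x - x - \<sigma> * \<omega> s) + (x + \<sigma> * \<omega> s))
      \<longlongrightarrow> (\<phi> t \<omega> x - x - \<sigma> * \<omega> t) + (x + \<sigma> * \<omega> t)) (at_right t)"
    by (rule tendsto_add)
  then show ?thesis by simp
qed

text \<open>While the solution stays nonnegative, its drift is bounded above, so a sufficiently negative
  increment of the driving path forces it across \<open>0\<close>.\<close>

lemma hits_negative:
  assumes "\<omega> \<in> paths" and low: "\<sigma> * \<omega> 1 < - (x + \<bar>\<beta>\<bar> * (\<bar>\<beta>\<bar> + 1))"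
  shows "\<exists>q\<in>\<rat> \<inter> {0..1}. \<phi> q \<omega> x < 0"
proof (rule ccontr)
  assume "\<not> ?thesis"
  then have pos_rat: "0 \<le> \<phi> q \<omega> x" if "q \<in> \<rat>" "0 \<le> q" "q \<le> 1" for q
    using that by (metis IntI atLeastAtMost_iff not_le)
  \<comment> \<open>A negative value would persist to the right, up to some rational time. The
    endpoint 1 has no room on its right within [0,1], but is rational itself.\<close>
  have pos: "0 \<le> \<phi> s \<omega> x" if "s \<in> {0..1}" for s
  proof (rule ccontr)
    assume neg: "\<not> ?thesis"
    then have "s < 1" using that pos_rat[of 1] by (cases "s = 1") auto
    have "\<forall>\<^sub>F r in at_right s. \<phi> r \<omega> x < 0"
      using order_tendstoD(2)[OF right_continuous_flow[of \<omega> s x]] neg that assms by auto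
    then obtain d where d: "s < d" "\<And>r. s < r \<Longrightarrow> r < d \<Longrightarrow> \<phi> r \<omega> x < 0"
      using \<open>s < 1\<close> by (auto simp: eventually_at_right[of s 1])
    obtain q where "q \<in> \<rat>" "s < q" "q < min d 1"
      using Rats_dense_in_real[of s "min d 1"] d \<open>s < 1\<close> by auto
    with d(2)[of q] pos_rat[of q] that show False by auto
  qed
  have "\<phi> 1 \<omega> x - x - \<sigma> * \<omega> 1 \<le> (1 - 0) * (\<bar>\<beta>\<bar> * (\<bar>\<beta>\<bar> + 1))"
  proof (rule has_integral_le[OF solution[of \<omega> 1 x]])
    show "((\<lambda>_. \<bar>\<beta>\<bar> * (\<bar>\<beta>\<bar> + 1)) has_integral (1 - 0) * (\<bar>\<beta>\<bar> * (\<bar>\<beta>\<bar> + 1))) {0..1::real}"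
      using has_integral_const_real[of "\<bar>\<beta>\<bar> * (\<bar>\<beta>\<bar> + 1)" 0 1] by simp
    fix s :: real assume "s \<in> {0..1}"
    define z where "z = \<phi> s \<omega> x"
    have z: "0 \<le> z" using pos[OF \<open>s \<in> {0..1}\<close>] by (simp add: z_def)
    have "\<beta> * z \<le> \<bar>\<beta>\<bar> * z" using z by (intro mult_right_mono) auto
    \<comment> \<open>A crude maximum over z \<ge> 0: up to |\<beta>| + 1 the cube is dropped, and
      beyond that z^2 \<ge> |\<beta>| makes the expression nonpositive.\<close>
    moreover have "\<bar>\<beta>\<bar> * z - z ^ 3 \<le> \<bar>\<beta>\<bar> * (\<bar>\<beta>\<bar> + 1)"
    proof (cases "z \<le> \<bar>\<beta>\<bar> + 1")
      case True
      then have "\<bar>\<beta>\<bar> * z \<le> \<bar>\<beta>\<bar> * (\<bar>\<beta>\<bar> + 1)" by (intro mult_left_mono) auto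
      then show ?thesis using z by (smt (verit) zero_le_power)
    next
      case False
      then have "\<bar>\<beta>\<bar> \<le> z * z"
        using mult_mono[of "\<bar>\<beta>\<bar>" z 1 z] by auto
      then have "\<bar>\<beta>\<bar> * z \<le> z * z * z" using z by (rule mult_right_mono)
      then have "\<bar>\<beta>\<bar> * z - z ^ 3 \<le> 0" by (simp add: power3_eq_cube)
      also have "0 \<le> \<bar>\<beta>\<bar> * (\<bar>\<beta>\<bar> + 1)" by simp
      finally show ?thesis .
    qed
    ultimately show "\<beta> * \<phi> s \<omega> x - \<phi> s \<omega> x ^ 3 \<le> \<bar>\<beta>\<bar> * (\<bar>\<beta>\<bar> + 1)"
      by (simp add: z_def)
  qed (use assms in auto)
  with low pos[of 1] show False by simp
qed

text \<open>The position at time 0 of the solution started from +\<infinity> at time -t. By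
  monotonicity natural starting points suffice, which keeps the supremum countable and hence
  measurable; for t > 0 it is finite by \<open>coming_down\<close>.\<close>

definition upper :: "real \<Rightarrow> (real \<Rightarrow> real) \<Rightarrow> real" where
  "upper t \<omega> = (SUP k::nat. \<phi> t (shift (- t) \<omega>) (real k))"

text \<open>Integer times suffice because \<open>upper\<close> decreases in t. \<open>Suc\<close>
  leaves out t = 0, where the supremum runs over an unbounded set.\<close>

definition upper_limit :: "(real \<Rightarrow> real) \<Rightarrow> real" where
  "upper_limit \<omega> = (INF n::nat. upper (real (Suc n)) \<omega>)"

lemma bdd_above_flow:
  assumes "\<omega> \<in> paths" "0 < t"
  shows "bdd_above (range (\<lambda>k::nat. \<phi> t \<omega> (real k)))"
  using coming_down[OF assms] by (auto simp: bdd_above_def)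

lemma flow_le_upper:
  assumes "\<omega> \<in> paths" "0 < t"
  shows "\<phi> t (shift (- t) \<omega>) x \<le> upper t \<omega>"
proof -
  obtain k :: nat where "x \<le> real k" using real_arch_simple by blast
  then have "\<phi> t (shift (- t) \<omega>) x \<le> \<phi> t (shift (- t) \<omega>) (real k)"
    using assms by (intro mono_flow) auto
  also have "\<dots> \<le> upper t \<omega>"
    unfolding upper_def using assms by (intro cSUP_upper bdd_above_flow) auto
  finally show ?thesis .
qed

lemma flow_le_upper_shift:
  assumes "\<omega> \<in> paths" "0 < t"
  shows "\<phi> t \<omega> x \<le> upper t (shift t \<omega>)"
  using flow_le_upper[of "shift t \<omega>" t x] assms by simp

text \<open>The cocycle property for the starting point +\<infinity>: the flow map is continuous, so
  it can be exchanged with the limit along the starting points k.\<close>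

lemma upper_add_shift:
  assumes "\<omega> \<in> paths" "0 < s" "0 \<le> t"
  shows "upper (s + t) (shift t \<omega>) = \<phi> t \<omega> (upper s \<omega>)"
proof -
  define f where "f k = \<phi> s (shift (- s) \<omega>) (real k)" for k :: nat
  have eq: "\<phi> (s + t) (shift (- (s + t)) (shift t \<omega>)) (real k) = \<phi> t \<omega> (f k)" for k
    using cocycle[of "shift (- s) \<omega>" s t "real k"] assms by (simp add: shift_shift f_def)
  have "incseq f"
    using assms by (auto simp: f_def incseq_def intro!: mono_flow)
  moreover have bdd: "bdd_above (range f)"
    unfolding f_def using assms by (intro bdd_above_flow) auto
  ultimately have lim: "f \<longlonglongrightarrow> upper s \<omega>"
    unfolding upper_def f_def[symmetric] by (rule LIMSEQ_incseq_SUP[rotated])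
  then have "(\<lambda>k. \<phi> t \<omega> (f k)) \<longlonglongrightarrow> \<phi> t \<omega> (upper s \<omega>)"
    using continuous_flow[of \<omega> t] assms
    by (intro continuous_on_tendsto_compose[of UNIV "\<phi> t \<omega>"]) auto
  moreover have "(\<lambda>k. \<phi> t \<omega> (f k)) \<longlonglongrightarrow> upper (s + t) (shift t \<omega>)"
    unfolding upper_def eq
  proof (rule LIMSEQ_incseq_SUP)
    show "bdd_above (range (\<lambda>k. \<phi> t \<omega> (f k)))"
      using bdd_above_flow[of "shift (- (s + t)) (shift t \<omega>)" "s + t"] assms by (simp only: eq) simp
    show "incseq (\<lambda>k. \<phi> t \<omega> (f k))"
      using \<open>incseq f\<close> assms by (auto simp: incseq_def intro!: mono_flow)
  qed
  ultimately show ?thesis by (rule LIMSEQ_unique[symmetric])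
qed

text \<open>Started from +\<infinity> at the earlier time -t, the solution is already finite at time
  -s, hence stays below the one that starts from +\<infinity> there.\<close>

lemma upper_antimono:
  assumes "\<omega> \<in> paths" "0 < s" "s \<le> t"
  shows "upper t \<omega> \<le> upper s \<omega>"
proof (cases "s = t")
  case False
  then have "upper (t - s + s) (shift s (shift (- s) \<omega>)) = \<phi> s (shift (- s) \<omega>) (upper (t - s) (shift (- s) \<omega>))"
    using assms by (intro upper_add_shift) auto
  also have "\<dots> \<le> upper s \<omega>" using assms by (intro flow_le_upper) auto
  finally show ?thesis using assms by simp
qed simp

end

text \<open>The drift is odd, so -X solves the equation with -\<sigma> when X solves it with
  \<sigma>. Interpreting the locale for this cocycle yields the mirror image of each result.\<close>

definition reflect :: "cocycle \<Rightarrow> cocycle" where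
  "reflect \<phi> = (\<lambda>t \<omega> x. - \<phi> t \<omega> (- x))"

context cubic_flow
begin

lemma cubic_flow_reflect: "cubic_flow \<beta> (- \<sigma>) (reflect \<phi>)"
proof
  have "(\<lambda>(t, \<omega>, x). \<phi> t \<omega> x)
      \<in> borel_measurable (restrict_space borel {0..} \<Otimes>\<^sub>M (path_space \<Otimes>\<^sub>M borel))"
    using generated by (auto simp: generated_by_sde_def random_dynamical_system_def)
  moreover have "(\<lambda>(t, \<omega>, x). (t, \<omega>, - x)) \<in> measurable
      (restrict_space borel {0..} \<Otimes>\<^sub>M (path_space \<Otimes>\<^sub>M (borel :: real measure)))
      (restrict_space borel {0..} \<Otimes>\<^sub>M (path_space \<Otimes>\<^sub>M (borel :: real measure)))"
    unfolding split_beta'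
    by (intro measurable_Pair measurable_fst borel_measurable_uminus
        measurable_compose[OF measurable_snd measurable_fst] measurable_compose[OF measurable_snd measurable_snd])
  ultimately have "(\<lambda>p. - (\<lambda>(t, \<omega>, x). \<phi> t \<omega> x) ((\<lambda>(t, \<omega>, x). (t, \<omega>, - x)) p))
      \<in> borel_measurable (restrict_space borel {0..} \<Otimes>\<^sub>M (path_space \<Otimes>\<^sub>M borel))"
    by (rule borel_measurable_uminus[OF measurable_compose[rotated]])
  then have "(\<lambda>(t, \<omega>, x). reflect \<phi> t \<omega> x)
      \<in> borel_measurable (restrict_space borel {0..} \<Otimes>\<^sub>M (path_space \<Otimes>\<^sub>M borel))"
    by (simp add: reflect_def split_beta')
  moreover have "((\<lambda>s. \<beta> * reflect \<phi> s \<omega> x - reflect \<phi> s \<omega> x ^ 3)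
      has_integral (reflect \<phi> t \<omega> x - x - - \<sigma> * \<omega> t)) {0..t}" if "\<omega> \<in> paths" "0 \<le> t" for \<omega> x t
    using has_integral_neg[OF solution[OF that, of "- x"]] by (simp add: reflect_def algebra_simps)
  ultimately show "generated_by_sde (\<lambda>x. \<beta> * x - x ^ 3) (- \<sigma>) (reflect \<phi>)"
    using cocycle initial
    by (auto simp: generated_by_sde_def random_dynamical_system_def reflect_def)
qed

text \<open>Unfolded, this is the infimum over k of
  \<open>\<phi> t (shift (- t) \<omega>) (- real k)\<close>, the flow from -\<infinity>.\<close>

definition lower :: "real \<Rightarrow> (real \<Rightarrow> real) \<Rightarrow> real" where
  "lower t \<omega> = - cubic_flow.upper (reflect \<phi>) t \<omega>"

definition lower_limit :: "(real \<Rightarrow> real) \<Rightarrow> real" where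
  "lower_limit \<omega> = - cubic_flow.upper_limit (reflect \<phi>) \<omega>"

lemma lower_le_flow:
  assumes "\<omega> \<in> paths" "0 < t"
  shows "lower t \<omega> \<le> \<phi> t (shift (- t) \<omega>) x"
proof -
  interpret r: cubic_flow \<beta> "- \<sigma>" "reflect \<phi>" by (rule cubic_flow_reflect)
  show ?thesis using r.flow_le_upper[OF assms, of "- x"] by (simp add: lower_def reflect_def)
qed

lemma lower_shift_le_flow:
  assumes "\<omega> \<in> paths" "0 < t"
  shows "lower t (shift t \<omega>) \<le> \<phi> t \<omega> x"
  using lower_le_flow[of "shift t \<omega>" t x] assms by simp

lemma lower_le_upper:
  assumes "\<omega> \<in> paths" "0 < t"
  shows "lower t \<omega> \<le> upper t \<omega>"
  using lower_le_flow[OF assms, of 0] flow_le_upper[OF assms, of 0] by simp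

lemma lower_mono:
  assumes "\<omega> \<in> paths" "0 < s" "s \<le> t"
  shows "lower s \<omega> \<le> lower t \<omega>"
proof -
  interpret r: cubic_flow \<beta> "- \<sigma>" "reflect \<phi>" by (rule cubic_flow_reflect)
  show ?thesis using r.upper_antimono[OF assms] by (simp add: lower_def)
qed

lemma upper_tendsto:
  assumes "\<omega> \<in> paths"
  shows "((\<lambda>t. upper t \<omega>) \<longlongrightarrow> upper_limit \<omega>) at_top"
proof -
  let ?u = "\<lambda>n::nat. upper (real (Suc n)) \<omega>"
  \<comment> \<open>A real infimum is meaningful only over a set bounded below; the increasing flow
    from -\<infinity> supplies the bound.\<close>
  have bdd: "bdd_below (range ?u)"
  proof (rule bdd_belowI2)
    fix n
    have "lower 1 \<omega> \<le> lower (real (Suc n)) \<omega>" by (intro lower_mono assms) auto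
    also have "\<dots> \<le> ?u n" by (intro lower_le_upper assms) auto
    finally show "lower 1 \<omega> \<le> ?u n" .
  qed
  have ge: "upper_limit \<omega> \<le> upper t \<omega>" if "0 < t" for t
  proof -
    obtain n where "t \<le> real n" using real_arch_simple by blast
    then have "?u n \<le> upper t \<omega>" using that by (intro upper_antimono assms) auto
    then show ?thesis unfolding upper_limit_def using bdd by (rule cINF_lower2[rotated -1]) auto
  qed
  show ?thesis
  proof (rule order_tendstoI)
    fix a assume "a < upper_limit \<omega>"
    then show "\<forall>\<^sub>F t in at_top. a < upper t \<omega>"
      by (intro eventually_mono[OF eventually_gt_at_top[of 0]]) (rule less_le_trans[OF _ ge])
  next
    fix a assume "upper_limit \<omega> < a"
    then obtain n where "?u n < a"
      unfolding upper_limit_def using bdd by (subst (asm) cINF_less_iff) auto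
    then show "\<forall>\<^sub>F t in at_top. upper t \<omega> < a"
      by (intro eventually_mono[OF eventually_ge_at_top[of "real (Suc n)"]])
        (rule le_less_trans[OF upper_antimono[OF assms]], auto)
  qed
qed

lemma lower_tendsto:
  assumes "\<omega> \<in> paths"
  shows "((\<lambda>t. lower t \<omega>) \<longlongrightarrow> lower_limit \<omega>) at_top"
proof -
  interpret r: cubic_flow \<beta> "- \<sigma>" "reflect \<phi>" by (rule cubic_flow_reflect)
  show ?thesis
    unfolding lower_def lower_limit_def by (intro tendsto_intros r.upper_tendsto assms)
qed

lemma lower_limit_le_upper_limit:
  assumes "\<omega> \<in> paths"
  shows "lower_limit \<omega> \<le> upper_limit \<omega>"
  using lower_le_upper[OF assms] 
  by (intro tendsto_le[OF _ upper_tendsto lower_tendsto] assms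
      eventually_mono[OF eventually_gt_at_top[of 0]]) auto

text \<open>Equivariance follows from \<open>upper_add_shift\<close> as s tends to infinity, again
  by continuity of the flow map.\<close>

lemma upper_limit_shift:
  assumes "\<omega> \<in> paths" "0 \<le> t"
  shows "upper_limit (shift t \<omega>) = \<phi> t \<omega> (upper_limit \<omega>)"
proof (rule tendsto_unique)
  have "filterlim (\<lambda>s. s + t) at_top at_top"
    by (rule filterlim_tendsto_add_at_top[OF tendsto_const filterlim_ident, of t, simplified add.commute])
  then show "((\<lambda>s. upper (s + t) (shift t \<omega>)) \<longlongrightarrow> upper_limit (shift t \<omega>)) at_top"
    by (rule filterlim_compose[OF upper_tendsto[OF shift_paths[OF assms(1)]]])
  have "((\<lambda>s. \<phi> t \<omega> (upper s \<omega>)) \<longlongrightarrow> \<phi> t \<omega> (upper_limit \<omega>)) at_top"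
    using continuous_flow[OF assms] upper_tendsto[OF assms(1)]
    by (intro continuous_on_tendsto_compose[of UNIV "\<phi> t \<omega>"]) auto
  then show "((\<lambda>s. upper (s + t) (shift t \<omega>)) \<longlongrightarrow> \<phi> t \<omega> (upper_limit \<omega>)) at_top"
    by (rule Lim_transform_eventually)
      (rule eventually_mono[OF eventually_gt_at_top[of 0]], simp add: upper_add_shift[OF assms(1) _ assms(2)])
qed simp

lemma lower_limit_shift:
  assumes "\<omega> \<in> paths" "0 \<le> t"
  shows "lower_limit (shift t \<omega>) = \<phi> t \<omega> (lower_limit \<omega>)"
proof -
  interpret r: cubic_flow \<beta> "- \<sigma>" "reflect \<phi>" by (rule cubic_flow_reflect)
  show ?thesis using r.upper_limit_shift[OF assms] by (simp add: lower_limit_def reflect_def)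
qed

lemma flow_future_part:
  assumes "\<omega> \<in> paths" "0 \<le> t"
  shows "\<phi> t (future_part \<omega>) x = \<phi> t \<omega> x"
  by (intro flow_cong future_part_paths assms) (simp add: future_part_def)

lemma upper_past_part:
  assumes "\<omega> \<in> paths" "0 < t"
  shows "upper t (past_part \<omega>) = upper t \<omega>"
proof -
  have "\<phi> t (shift (- t) (past_part \<omega>)) x = \<phi> t (shift (- t) \<omega>) x" for x
  proof (rule flow_cong)
    fix s assume "s \<in> {0..t}"
    then show "shift (- t) (past_part \<omega>) s = shift (- t) \<omega> s"
      using assms by (simp add: past_part_def shift_def)
  qed (use assms in simp_all)
  then show ?thesis by (simp add: upper_def)
qed

lemma upper_limit_past_part:
  assumes "\<omega> \<in> paths"
  shows "upper_limit (past_part \<omega>) = upper_limit \<omega>"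
  using assms by (simp add: upper_limit_def upper_past_part)

lemma lower_limit_past_part:
  assumes "\<omega> \<in> paths"
  shows "lower_limit (past_part \<omega>) = lower_limit \<omega>"
proof -
  interpret r: cubic_flow \<beta> "- \<sigma>" "reflect \<phi>" by (rule cubic_flow_reflect)
  show ?thesis using r.upper_limit_past_part[OF assms] by (simp add: lower_limit_def)
qed

lemma measurable_upper [measurable]:
  assumes "0 < t"
  shows "upper t \<in> borel_measurable path_space"
proof -
  have "(\<lambda>\<omega>. SUP k::nat. \<phi> t (shift (- t) \<omega>) (real k)) \<in> borel_measurable path_space"
    using assms
    by (intro borel_measurable_cSUP measurable_flow_compose measurable_shift bdd_above_flow) auto
  then show ?thesis by (simp add: upper_def[abs_def])
qed

lemma measurable_upper_limit [measurable]: "upper_limit \<in> borel_measurable path_space"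
proof (rule borel_measurable_LIMSEQ_real)
  fix \<omega> assume "\<omega> \<in> space path_space"
  then show "(\<lambda>n. upper (real (Suc n)) \<omega>) \<longlonglongrightarrow> upper_limit \<omega>"
    by (intro filterlim_compose[OF upper_tendsto] filterlim_compose[OF filterlim_real_sequentially]
        filterlim_Suc) auto
qed simp

lemma measurable_lower_limit [measurable]: "lower_limit \<in> borel_measurable path_space"
proof -
  interpret r: cubic_flow \<beta> "- \<sigma>" "reflect \<phi>" by (rule cubic_flow_reflect)
  show ?thesis unfolding lower_limit_def[abs_def] by measurable
qed

lemma measurable_upper_limit_past: "upper_limit \<in> borel_measurable past"
  using measurable_compose[OF measurable_past_part_past measurable_upper_limit]
  by (rule measurable_cong[THEN iffD1, rotated]) (simp add: upper_limit_past_part)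

lemma upper_limit_le_upper:
  assumes "\<omega> \<in> paths" "0 < t"
  shows "upper_limit \<omega> \<le> upper t \<omega>"
  by (rule tendsto_upperbound[OF upper_tendsto[OF assms(1)] eventually_mono[OF eventually_ge_at_top[of t]]])
    (use assms in \<open>auto intro: upper_antimono\<close>)

lemma lower_le_lower_limit:
  assumes "\<omega> \<in> paths" "0 < t"
  shows "lower t \<omega> \<le> lower_limit \<omega>"
  by (rule tendsto_lowerbound[OF lower_tendsto[OF assms(1)] eventually_mono[OF eventually_ge_at_top[of t]]])
    (use assms in \<open>auto intro: lower_mono\<close>)

text \<open>The set is closed and downward closed, since the flow map is continuous and increasing.
  Thus a level c at time t becomes a level z at time 0, or disappears.\<close>

lemma flow_sublevel:
  assumes "\<omega> \<in> paths" "0 \<le> t"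
  shows "{x. \<phi> t \<omega> x \<le> c} = {} \<or> {x. \<phi> t \<omega> x \<le> c} = UNIV \<or> (\<exists>z. {x. \<phi> t \<omega> x \<le> c} = {..z})"
proof -
  define A where "A = {x. \<phi> t \<omega> x \<le> c}"
  have closed: "closed A"
    using continuous_closed_vimage[of "{..c}" "\<phi> t \<omega>"] continuous_flow[OF assms]
    by (auto simp: A_def vimage_def continuous_on_eq_continuous_at)
  have down: "x \<in> A" if "x \<le> y" "y \<in> A" for x y
    using mono_flow[OF assms that(1)] that(2) by (auto simp: A_def)
  have "A = {..Sup A}" if "A \<noteq> {}" and univ: "A \<noteq> UNIV"
  proof -
    obtain u where "u \<notin> A" using univ by blast
    then have bdd: "bdd_above A"
      using down by (intro bdd_aboveI[of _ u]) (meson linear)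
    have "Sup A \<in> A" using \<open>A \<noteq> {}\<close> bdd closed by (intro closed_contains_Sup)
    then show ?thesis using down cSup_upper[OF _ bdd] by auto
  qed
  then show ?thesis unfolding A_def[symmetric] by blast
qed

end

section \<open>Stationarity and independence of past and future\<close>

definition increments :: "(nat \<Rightarrow> real) \<Rightarrow> (real \<Rightarrow> real) \<Rightarrow> nat \<Rightarrow> real" where
  "increments \<tau> \<omega> = (\<lambda>i. \<omega> (\<tau> (Suc i)) - \<omega> (\<tau> i))"

lemma path_eq_sum_increments:
  assumes "\<omega> \<in> paths" "\<tau> m = 0"
  shows "m \<le> i \<Longrightarrow> \<omega> (\<tau> i) = (\<Sum>j\<in>{m..<i}. increments \<tau> \<omega> j)"
    and "i \<le> m \<Longrightarrow> \<omega> (\<tau> i) = - (\<Sum>j\<in>{i..<m}. increments \<tau> \<omega> j)"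
  using assms sum_Suc_diff'[of m i "\<lambda>j. \<omega> (\<tau> j)"] sum_Suc_diff'[of i m "\<lambda>j. \<omega> (\<tau> j)"]
  by (simp_all add: increments_def paths_def)

text \<open>Independence is given for increments along monotone sequences. Placing 0, where every
  path vanishes, at index m makes values at times \<le> 0 depend on increments of index below m, and
  values at times \<ge> 0 on those from m on.\<close>

lemma finite_times_enumeration:
  fixes F :: "real set"
  assumes "finite F"
  shows "\<exists>(\<tau> :: nat \<Rightarrow> real) m. mono \<tau> \<and> \<tau> m = 0 \<and> (\<forall>s\<in>F. s \<le> 0 \<longrightarrow> (\<exists>i\<le>m. \<tau> i = s))
           \<and> (\<forall>s\<in>F. 0 \<le> s \<longrightarrow> (\<exists>i\<ge>m. \<tau> i = s))"
proof -
  define xs where "xs = sorted_list_of_set (insert 0 F)"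
  have xs: "sorted xs" "set xs = insert 0 F"
    using assms by (simp_all only: xs_def sorted_sorted_list_of_set set_sorted_list_of_set finite_insert)
  then have "xs \<noteq> []" by auto
  \<comment> \<open>The finite list is continued by its last entry, which keeps the sequence
    monotone on all indices.\<close>
  define \<tau> where "\<tau> i = xs ! min i (length xs - 1)" for i
  have "mono \<tau>"
  proof (rule monoI)
    fix i j :: nat assume "i \<le> j"
    have "min i (length xs - 1) \<le> min j (length xs - 1)" using \<open>i \<le> j\<close> by simp
    moreover have "min j (length xs - 1) < length xs" using \<open>xs \<noteq> []\<close> by (simp add: min.strict_coboundedI2)
    ultimately show "\<tau> i \<le> \<tau> j" unfolding \<tau>_def by (rule sorted_nth_mono[OF xs(1)])
  qed
  have ex: "\<exists>i. \<tau> i = s" if "s \<in> insert 0 F" for s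
  proof -
    from that have "s \<in> set xs" by (simp only: xs(2))
    then obtain i where "i < length xs" "xs ! i = s"
      unfolding in_set_conv_nth by (elim exE conjE)
    moreover from this have "min i (length xs - 1) = i" by linarith
    ultimately have "\<tau> i = s" by (simp add: \<tau>_def)
    then show ?thesis ..
  qed
  obtain m where m: "\<tau> m = 0" using ex by auto
  have "\<exists>i\<le>m. \<tau> i = s" if s: "s \<in> F" "s \<le> 0" for s
  proof -
    obtain i where i: "\<tau> i = s" using ex s by auto
    show ?thesis
    proof (cases "i \<le> m")
      case False
      then have "0 \<le> s" using monoD[OF \<open>mono \<tau>\<close>, of m i] m i by simp
      then show ?thesis using s m by auto
    qed (use i in auto)
  qed
  moreover have "\<exists>i\<ge>m. \<tau> i = s" if s: "s \<in> F" "0 \<le> s" for s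
  proof -
    obtain i where i: "\<tau> i = s" using ex s by auto
    show ?thesis
    proof (cases "m \<le> i")
      case False
      then have "s \<le> 0" using monoD[OF \<open>mono \<tau>\<close>, of i m] m i by simp
      then show ?thesis using s m by auto
    qed (use i in auto)
  qed
  ultimately show ?thesis using \<open>mono \<tau>\<close> m by (intro exI[of _ \<tau>] exI[of _ m] conjI) auto
qed

lemma sets_Collect_finite_constraints:
  assumes "finite F" "\<And>s. s \<in> F \<Longrightarrow> f s \<in> measurable M N" "\<And>s. s \<in> F \<Longrightarrow> B s \<in> sets N"
  shows "{x \<in> space M. \<forall>s\<in>F. f s x \<in> B s} \<in> sets M"
proof (rule sets.sets_Collect_finite_All[OF _ \<open>finite F\<close>])
  fix s assume "s \<in> F"
  then have "f s -` B s \<inter> space M \<in> sets M" by (intro measurable_sets[of _ M N] assms)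
  moreover have "f s -` B s \<inter> space M = {x \<in> space M. f s x \<in> B s}" by auto
  ultimately show "{x \<in> space M. f s x \<in> B s} \<in> sets M" by simp
qed

text \<open>An intersection-stable family serving three purposes: I = UNIV identifies laws on
  \<open>path_space\<close>, while \<open>{..0}\<close> and \<open>{0..}\<close> generate past and
  future.\<close>

definition path_cylinders :: "real set \<Rightarrow> (real \<Rightarrow> real) set set" where
  "path_cylinders I = {{\<omega> \<in> paths. \<forall>s\<in>F. \<omega> s \<in> B s} | F B. finite F \<and> F \<subseteq> I \<and> (\<forall>s\<in>F. B s \<in> sets borel)}"

lemma path_cylindersI:
  "finite F \<Longrightarrow> F \<subseteq> I \<Longrightarrow> (\<And>s. s \<in> F \<Longrightarrow> B s \<in> sets borel) \<Longrightarrow>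
     {\<omega> \<in> paths. \<forall>s\<in>F. \<omega> s \<in> B s} \<in> path_cylinders I"
  unfolding path_cylinders_def by blast

lemma path_cylindersE:
  assumes "A \<in> path_cylinders I"
  obtains F B where "A = {\<omega> \<in> paths. \<forall>s\<in>F. \<omega> s \<in> B s}" "finite F" "F \<subseteq> I" "\<And>s. s \<in> F \<Longrightarrow> B s \<in> sets borel"
proof -
  obtain F B where "A = {\<omega> \<in> paths. \<forall>s\<in>F. \<omega> s \<in> B s} \<and> finite F \<and> F \<subseteq> I \<and> (\<forall>s\<in>F. B s \<in> sets borel)"
    using assms unfolding path_cylinders_def mem_Collect_eq by (elim exE)
  then show thesis by (intro that[of F B]) auto
qed

lemma path_cylinders_subset: "path_cylinders I \<subseteq> sets path_space"
proof
  fix A assume "A \<in> path_cylinders I"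
  then obtain F B where A: "A = {\<omega> \<in> paths. \<forall>s\<in>F. \<omega> s \<in> B s}" and "finite F" "F \<subseteq> I" "\<And>s. s \<in> F \<Longrightarrow> B s \<in> sets borel"
    by (rule path_cylindersE) (rule that)
  then have "{\<omega> \<in> space path_space. \<forall>s\<in>F. \<omega> s \<in> B s} \<in> sets path_space"
    by (intro sets_Collect_finite_constraints[of F "\<lambda>s \<omega>. \<omega> s" _ borel] measurable_eval)
  then show "A \<in> sets path_space" by (simp add: A)
qed

lemma Int_stable_path_cylinders: "Int_stable (path_cylinders I)"
proof (rule Int_stableI)
  fix A A' assume AA': "A \<in> path_cylinders I" "A' \<in> path_cylinders I"
  obtain F B where A: "A = {\<omega> \<in> paths. \<forall>s\<in>F. \<omega> s \<in> B s}" "finite F" "F \<subseteq> I" "\<And>s. s \<in> F \<Longrightarrow> B s \<in> sets borel"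
    by (rule path_cylindersE[OF AA'(1)]) (rule that)
  obtain F' B' where A': "A' = {\<omega> \<in> paths. \<forall>s\<in>F'. \<omega> s \<in> B' s}" "finite F'" "F' \<subseteq> I" "\<And>s. s \<in> F' \<Longrightarrow> B' s \<in> sets borel"
    by (rule path_cylindersE[OF AA'(2)]) (rule that)
  define C where "C s = (if s \<in> F then B s else UNIV) \<inter> (if s \<in> F' then B' s else UNIV)" for s
  have "A \<inter> A' = {\<omega> \<in> paths. \<forall>s\<in>F \<union> F'. \<omega> s \<in> C s}"
    by (auto simp: A(1) A'(1) C_def split: if_splits)
  also have "\<dots> \<in> path_cylinders I"
    using A A' by (intro path_cylindersI) (auto simp: C_def)
  finally show "A \<inter> A' \<in> path_cylinders I" .
qed

text \<open>\<open>paths\<close> is not measurable in the uncountable product, so the laws are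
  pushed forward along the inclusion and compared there; the sets of \<open>path_space\<close> are
  the traces of product-measurable sets.\<close>

lemma measure_eqI_path_space:
  assumes P: "prob_space P" "sets P = sets path_space" and Q: "prob_space Q" "sets Q = sets path_space"
    and eq: "\<And>A. A \<in> path_cylinders UNIV \<Longrightarrow> emeasure P A = emeasure Q A"
  shows "P = Q"
proof -
  interpret P: prob_space P by fact
  let ?\<Pi> = "Pi\<^sub>M UNIV (\<lambda>_::real. borel :: real measure)"
  have [simp]: "space P = paths" "space Q = paths"
    using sets_eq_imp_space_eq[OF P(2)] sets_eq_imp_space_eq[OF Q(2)] by simp_all
  have id: "(\<lambda>\<omega>. \<omega>) \<in> measurable path_space ?\<Pi>"
    unfolding path_space_def by (intro measurable_restrict_space1) simp
  then have idP: "(\<lambda>\<omega>. \<omega>) \<in> measurable P ?\<Pi>" and idQ: "(\<lambda>\<omega>. \<omega>) \<in> measurable Q ?\<Pi>"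
    using P(2) Q(2) measurable_cong_sets by blast+
  have "distr P ?\<Pi> (\<lambda>\<omega>. \<omega>) = distr Q ?\<Pi> (\<lambda>\<omega>. \<omega>)"
  proof (rule measure_eqI_PiM_infinite)
    show "finite_measure (distr P ?\<Pi> (\<lambda>\<omega>. \<omega>))"
      using P.prob_space_distr[OF idP] by (rule prob_space.finite_measure)
    fix A :: "real \<Rightarrow> real set" and J assume J: "finite J" "J \<subseteq> UNIV" "\<And>i. i \<in> J \<Longrightarrow> A i \<in> sets borel"
    have emb: "prod_emb UNIV (\<lambda>_. borel) J (Pi\<^sub>E J A) = {\<omega>. \<forall>s\<in>J. \<omega> s \<in> A s}"
      by (auto simp: prod_emb_def PiE_iff)
    have [measurable]: "prod_emb UNIV (\<lambda>_. borel) J (Pi\<^sub>E J A) \<in> sets ?\<Pi>"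
      using J by (intro sets_PiM_I) auto
    have "(\<lambda>\<omega>. \<omega>) -` prod_emb UNIV (\<lambda>_. borel) J (Pi\<^sub>E J A) \<inter> paths = {\<omega> \<in> paths. \<forall>s\<in>J. \<omega> s \<in> A s}"
      by (auto simp: emb)
    then show "emeasure (distr P ?\<Pi> (\<lambda>\<omega>. \<omega>)) (prod_emb UNIV (\<lambda>_. borel) J (Pi\<^sub>E J A))
        = emeasure (distr Q ?\<Pi> (\<lambda>\<omega>. \<omega>)) (prod_emb UNIV (\<lambda>_. borel) J (Pi\<^sub>E J A))"
      using eq[OF path_cylindersI[OF J(1) _ J(3)]] by (simp add: emeasure_distr idP idQ)
  qed simp_all
  then have D: "emeasure (distr P ?\<Pi> (\<lambda>\<omega>. \<omega>)) A = emeasure (distr Q ?\<Pi> (\<lambda>\<omega>. \<omega>)) A" for A by simp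
  show ?thesis
  proof (rule measure_eqI)
    fix A assume "A \<in> sets P"
    then obtain A' where "A' \<in> sets ?\<Pi>" "A = paths \<inter> A'"
      unfolding P(2) path_space_def sets_restrict_space by auto
    then show "emeasure P A = emeasure Q A"
      using D[of A'] by (simp add: emeasure_distr idP idQ Int_commute)
  qed (simp add: P Q)
qed

locale levy_process = prob_space P for P :: "(real \<Rightarrow> real) measure" +
  assumes two_sided_levy: "two_sided_levy_process P"
begin

lemma sets_eq [measurable_cong]: "sets P = sets path_space"
  using two_sided_levy by (simp add: two_sided_levy_process_def)

lemma space_eq [simp]: "space P = paths"
  using sets_eq_imp_space_eq[OF sets_eq] by simp

lemma measurable_P [simp]: "measurable P M = measurable path_space M"
  by (rule measurable_cong_sets) (simp_all add: sets_eq)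

lemma indep_increments: "mono \<tau> \<Longrightarrow> indep_vars (\<lambda>_. borel) (\<lambda>i \<omega>. increments \<tau> \<omega> i) UNIV"
  using two_sided_levy by (simp add: two_sided_levy_process_def increments_def)

lemma stationary_increments:
  "distr P borel (\<lambda>\<omega>. \<omega> (t + h) - \<omega> (s + h)) = distr P borel (\<lambda>\<omega>. \<omega> t - \<omega> s)"
  using two_sided_levy by (simp add: two_sided_levy_process_def)

lemma measurable_increments: "increments \<tau> \<in> measurable path_space (Pi\<^sub>M UNIV (\<lambda>_. borel))"
proof -
  have "(\<lambda>\<omega>. \<lambda>i\<in>UNIV. increments \<tau> \<omega> i) \<in> measurable path_space (Pi\<^sub>M UNIV (\<lambda>_. borel))"
    unfolding increments_def by measurable
  then show ?thesis by (simp add: restrict_UNIV)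
qed

lemma distr_increments:
  assumes "mono \<tau>"
  shows "distr P (Pi\<^sub>M UNIV (\<lambda>_. borel)) (increments \<tau>)
      = Pi\<^sub>M UNIV (\<lambda>i. distr P borel (\<lambda>\<omega>. \<omega> (\<tau> (Suc i)) - \<omega> (\<tau> i)))"
proof -
  have "distr P (Pi\<^sub>M UNIV (\<lambda>_. borel)) (\<lambda>\<omega>. \<lambda>i\<in>UNIV. increments \<tau> \<omega> i)
      = Pi\<^sub>M UNIV (\<lambda>i. distr P borel (\<lambda>\<omega>. increments \<tau> \<omega> i))"
    by (rule iffD1[OF indep_vars_iff_distr_eq_PiM indep_increments[OF assms]])
      (simp_all add: increments_def)
  then show ?thesis by (simp add: restrict_UNIV increments_def[abs_def])
qed

text \<open>The increments of the shifted path along \<tau> are those of the path along \<tau> + h.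
  Their joint laws are products by independence, with equal factors by stationarity, and they
  determine the path at any finitely many times.\<close>

lemma distr_shift: "distr P P (shift h) = P"
proof -
  have sh: "shift h \<in> measurable P P"
    using measurable_shift[of h] by (simp add: measurable_cong_sets[OF refl sets_eq])
  show ?thesis
  proof (rule measure_eqI_path_space)
    fix A assume "A \<in> path_cylinders UNIV"
    then obtain F B where A: "A = {\<omega> \<in> paths. \<forall>s\<in>F. \<omega> s \<in> B s}" and F: "finite F"
      and "F \<subseteq> UNIV" and B: "\<And>s. s \<in> F \<Longrightarrow> B s \<in> sets borel"
      by (rule path_cylindersE) (rule that)
    obtain \<tau> :: "nat \<Rightarrow> real" and m where \<tau>: "mono \<tau>" "\<tau> m = 0" "\<forall>s\<in>F. s \<le> 0 \<longrightarrow> (\<exists>i\<le>m. \<tau> i = s)" "\<forall>s\<in>F. 0 \<le> s \<longrightarrow> (\<exists>i\<ge>m. \<tau> i = s)"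
      using finite_times_enumeration[OF F] by blast
    have "\<forall>s\<in>F. \<exists>i. \<tau> i = s" using \<tau>(3,4) by (metis linear)
    then obtain i where i: "\<And>s. s \<in> F \<Longrightarrow> \<tau> (i s) = s" by metis
    define g where "g s v = (if m \<le> i s then (\<Sum>j\<in>{m..<i s}. v j) else - (\<Sum>j\<in>{i s..<m}. v j :: real))"
      for s and v :: "nat \<Rightarrow> real"
    have g: "\<omega> s = g s (increments \<tau> \<omega>)" if "\<omega> \<in> paths" "s \<in> F" for \<omega> s
      using path_eq_sum_increments[of \<omega> \<tau> m "i s", OF that(1) \<tau>(2)] i[OF that(2)] by (simp add: g_def)
    let ?\<Pi> = "Pi\<^sub>M UNIV (\<lambda>_::nat. borel :: real measure)"
    define V where "V = {v \<in> space ?\<Pi>. \<forall>s\<in>F. g s v \<in> B s}"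
    have g_meas: "g s \<in> borel_measurable ?\<Pi>" for s
      unfolding g_def[abs_def] by measurable
    have V: "V \<in> sets ?\<Pi>"
      unfolding V_def by (rule sets_Collect_finite_constraints[OF F g_meas B])
    have mono': "mono (\<lambda>i. \<tau> i + h)" using \<tau>(1) by (auto simp: mono_def)
    have "increments \<tau> (shift h \<omega>) = increments (\<lambda>i. \<tau> i + h) \<omega>" for \<omega>
      by (auto simp: increments_def shift_def add.commute)
    then have shA: "shift h -` A \<inter> paths = increments (\<lambda>i. \<tau> i + h) -` V \<inter> paths"
      using g[OF shift_paths] by (auto simp: A V_def space_PiM)
    have "A \<in> sets P" using path_cylinders_subset \<open>A \<in> _\<close> by (auto simp: sets_eq)
    then have "emeasure (distr P P (shift h)) A = emeasure P (increments (\<lambda>i. \<tau> i + h) -` V \<inter> paths)"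
      using sh by (simp add: emeasure_distr shA)
    also have "\<dots> = emeasure (distr P ?\<Pi> (increments (\<lambda>i. \<tau> i + h))) V"
      using V measurable_increments by (simp add: emeasure_distr)
    also have "\<dots> = emeasure (distr P ?\<Pi> (increments \<tau>)) V"
      unfolding distr_increments[OF mono'] distr_increments[OF \<tau>(1)] stationary_increments ..
    also have "\<dots> = emeasure P (increments \<tau> -` V \<inter> paths)"
      using V measurable_increments by (simp add: emeasure_distr)
    also have "increments \<tau> -` V \<inter> paths = A"
      using g by (auto simp: A V_def space_PiM)
    finally show "emeasure (distr P P (shift h)) A = emeasure P A" .
  qed (use prob_space_distr[OF sh] prob_space_axioms in \<open>auto simp: sets_eq\<close>)
qed

text \<open>Cylinders in the past and in the future are events of two disjoint blocks of independent
  increments. Intersection stability extends this to the generated \<sigma>-algebras.\<close>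

lemma indep_past_future: "indep_var path_space past_part path_space future_part"
proof -
  have ind: "indep_set (path_cylinders {..0}) (path_cylinders {0..})"
  proof (rule indep_setI)
    fix A A' assume AA': "A \<in> path_cylinders {..0}" "A' \<in> path_cylinders {0..}"
    obtain F B where A: "A = {\<omega> \<in> paths. \<forall>s\<in>F. \<omega> s \<in> B s}" "finite F" "F \<subseteq> {..0}" "\<And>s. s \<in> F \<Longrightarrow> B s \<in> sets borel"
      by (rule path_cylindersE[OF AA'(1)]) (rule that)
    obtain F' B' where A': "A' = {\<omega> \<in> paths. \<forall>s\<in>F'. \<omega> s \<in> B' s}" "finite F'" "F' \<subseteq> {0..}" "\<And>s. s \<in> F' \<Longrightarrow> B' s \<in> sets borel"
      by (rule path_cylindersE[OF AA'(2)]) (rule that)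
    obtain \<tau> :: "nat \<Rightarrow> real" and m where \<tau>: "mono \<tau>" "\<tau> m = 0"
      and neg: "\<forall>s\<in>F \<union> F'. s \<le> 0 \<longrightarrow> (\<exists>i\<le>m. \<tau> i = s)" and pos: "\<forall>s\<in>F \<union> F'. 0 \<le> s \<longrightarrow> (\<exists>i\<ge>m. \<tau> i = s)"
      using finite_times_enumeration[of "F \<union> F'"] A A' by auto
    have "\<forall>s\<in>F. \<exists>i. i \<le> m \<and> \<tau> i = s" using neg A(3) by auto
    then obtain i where i: "\<And>s. s \<in> F \<Longrightarrow> i s \<le> m \<and> \<tau> (i s) = s" by metis
    have "\<forall>s\<in>F'. \<exists>i. i \<ge> m \<and> \<tau> i = s" using pos A'(3) by auto
    then obtain i' where i': "\<And>s. s \<in> F' \<Longrightarrow> i' s \<ge> m \<and> \<tau> (i' s) = s" by metis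
    define X where "X \<omega> = restrict (increments \<tau> \<omega>) {..<m}" for \<omega>
    define Y where "Y \<omega> = restrict (increments \<tau> \<omega>) {m..}" for \<omega>
    let ?X = "Pi\<^sub>M {..<m} (\<lambda>_. borel :: real measure)" and ?Y = "Pi\<^sub>M {m..} (\<lambda>_. borel :: real measure)"
    have XY: "indep_var ?X X ?Y Y"
      unfolding X_def[abs_def] Y_def[abs_def]
      by (rule indep_var_restrict[OF indep_increments[OF \<tau>(1)]]) auto
    define V where "V = {v \<in> space ?X. \<forall>s\<in>F. - (\<Sum>j\<in>{i s..<m}. v j) \<in> B s}"
    define V' where "V' = {v \<in> space ?Y. \<forall>s\<in>F'. (\<Sum>j\<in>{m..<i' s}. v j) \<in> B' s}"
    have "(\<lambda>v. - (\<Sum>j\<in>{i s..<m}. v j)) \<in> borel_measurable ?X" for s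
      by (intro borel_measurable_uminus borel_measurable_sum measurable_component_singleton) auto
    then have V: "V \<in> sets ?X"
      unfolding V_def by (rule sets_Collect_finite_constraints[OF A(2) _ A(4)])
    have "(\<lambda>v. \<Sum>j\<in>{m..<i' s}. v j) \<in> borel_measurable ?Y" for s
      by (intro borel_measurable_sum measurable_component_singleton) auto
    then have V': "V' \<in> sets ?Y"
      unfolding V'_def by (rule sets_Collect_finite_constraints[OF A'(2) _ A'(4)])
    have "\<omega> s = - (\<Sum>j\<in>{i s..<m}. X \<omega> j)" if "\<omega> \<in> paths" "s \<in> F" for \<omega> s
      using path_eq_sum_increments(2)[of \<omega> \<tau> m "i s", OF that(1) \<tau>(2)] i[OF that(2)] by (simp add: X_def)
    then have AX: "A = X -` V \<inter> space P"
      by (auto simp: A(1) V_def space_PiM X_def)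
    have "\<omega> s = (\<Sum>j\<in>{m..<i' s}. Y \<omega> j)" if "\<omega> \<in> paths" "s \<in> F'" for \<omega> s
      using path_eq_sum_increments(1)[of \<omega> \<tau> m "i' s", OF that(1) \<tau>(2)] i'[OF that(2)] by (simp add: Y_def)
    then have A'Y: "A' = Y -` V' \<inter> space P"
      by (auto simp: A'(1) V'_def space_PiM Y_def)
    show "prob (A \<inter> A') = prob A * prob A'"
      unfolding AX A'Y using indep_varD[OF XY V V'] by (simp add: vimage_def Int_def conj_ac)
  qed (use path_cylinders_subset sets_eq in auto)
  have sig: "indep_set (sigma_sets paths (path_cylinders {..0})) (sigma_sets paths (path_cylinders {0..}))"
    using indep_set_sigma_sets[OF ind Int_stable_path_cylinders Int_stable_path_cylinders] by simp
  have into: "f -` A \<inter> paths \<in> sigma_sets paths (path_cylinders I)"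
    if A: "A \<in> sets path_space" and f: "\<And>\<omega>. \<omega> \<in> paths \<Longrightarrow> f \<omega> \<in> paths" and coord: "\<And>t. \<exists>s\<in>I. \<forall>\<omega>. f \<omega> t = \<omega> s"
    for f :: "(real \<Rightarrow> real) \<Rightarrow> real \<Rightarrow> real" and I A
  proof -
    have sub: "path_cylinders I \<subseteq> Pow paths" by (auto simp: path_cylinders_def)
    have "f \<in> measurable (sigma paths (path_cylinders I)) path_space"
    proof (rule measurable_into_path_space)
      fix t
      obtain s where s: "s \<in> I" "\<And>\<omega>. f \<omega> t = \<omega> s" using coord by blast
      show "(\<lambda>\<omega>. f \<omega> t) \<in> borel_measurable (sigma paths (path_cylinders I))"
      proof (rule measurableI)
        fix C :: "real set" assume "C \<in> sets borel"
        then have "{\<omega> \<in> paths. \<forall>r\<in>{s}. \<omega> r \<in> C} \<in> path_cylinders I"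
          using s by (intro path_cylindersI) auto
        moreover have "(\<lambda>\<omega>. f \<omega> t) -` C \<inter> paths = {\<omega> \<in> paths. \<forall>r\<in>{s}. \<omega> r \<in> C}"
          using s by auto
        ultimately show "(\<lambda>\<omega>. f \<omega> t) -` C \<inter> space (sigma paths (path_cylinders I))
            \<in> sets (sigma paths (path_cylinders I))"
          using sub by (simp add: space_measure_of sets_measure_of sigma_sets.Basic)
      qed simp
    qed (use f sub in \<open>auto simp: space_measure_of\<close>)
    from measurable_sets[OF this A] show ?thesis
      using sub by (simp add: space_measure_of sets_measure_of)
  qed
  have "\<exists>s\<in>{..0}. \<forall>\<omega>. past_part \<omega> t = \<omega> s" for t
    by (auto simp: past_part_def intro!: bexI[of _ "min t 0"])
  then have p: "sigma_sets paths {past_part -` A \<inter> paths |A. A \<in> sets path_space} \<subseteq> sigma_sets paths (path_cylinders {..0})"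
    by (intro sigma_sets_mono) (auto intro!: into)
  have "\<exists>s\<in>{0..}. \<forall>\<omega>. future_part \<omega> t = \<omega> s" for t
    by (auto simp: future_part_def intro!: bexI[of _ "max t 0"])
  then have f: "sigma_sets paths {future_part -` A \<inter> paths |A. A \<in> sets path_space} \<subseteq> sigma_sets paths (path_cylinders {0..})"
    by (intro sigma_sets_mono) (auto intro!: into)
  have "indep_set (sigma_sets paths {past_part -` A \<inter> paths |A. A \<in> sets path_space})
      (sigma_sets paths {future_part -` A \<inter> paths |A. A \<in> sets path_space})"
    using sig p f unfolding indep_set_def by (rule_tac indep_sets_mono_sets) (auto split: bool.split)
  then show ?thesis
    unfolding indep_var_eq by simp
qed

end

section \<open>Unboundedness of the noise\<close>

lemma jump_eq:
  assumes "(\<omega> \<longlongrightarrow> l) (at_left s)"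
  shows "jump \<omega> s = \<omega> s - l"
  using tendsto_Lim[OF _ assms] by (simp add: jump_def)

text \<open>Increments over the grid cells around s converge to the jump at s, while their lower
  bound -M/(n+1) tends to 0.\<close>

lemma jump_sign:
  assumes "\<omega> \<in> paths"
    and inc: "\<And>n k. - (M / real (Suc n)) \<le> \<kappa> * (\<omega> (of_int (k + 1) / real (Suc n)) - \<omega> (of_int k / real (Suc n)))"
  shows "0 \<le> \<kappa> * jump \<omega> s"
proof -
  obtain l where l: "(\<omega> \<longlongrightarrow> l) (at_left s)" and r: "(\<omega> \<longlongrightarrow> \<omega> s) (at_right s)"
    using assms(1) by (auto simp: paths_def cadlag_def)
  \<comment> \<open>Rounding up and subtracting 1 keeps p n strictly left of s even if s is a grid
    point, so the left limit is reached; q n may equal s, by right continuity.\<close>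
  define k where "k n = \<lceil>s * real (Suc n)\<rceil> - 1" for n
  define p where "p n = of_int (k n) / real (Suc n)" for n
  define q where "q n = of_int (k n + 1) / real (Suc n)" for n
  have p: "p n < s" "s - 1 / real (Suc n) \<le> p n" and q: "s \<le> q n" "q n \<le> s + 1 / real (Suc n)" for n
  proof -
    have "of_int (k n) < s * real (Suc n)" "s * real (Suc n) \<le> of_int (k n + 1)"
      unfolding k_def by linarith+
    then show "p n < s" "s \<le> q n"
      unfolding p_def q_def by (simp_all add: pos_divide_less_eq pos_le_divide_eq)
    moreover have "q n = p n + 1 / real (Suc n)"
      by (simp add: p_def q_def add_divide_distrib)
    ultimately show "s - 1 / real (Suc n) \<le> p n" "q n \<le> s + 1 / real (Suc n)"
      by linarith+
  qed
  have inv: "(\<lambda>n. 1 / real (Suc n)) \<longlonglongrightarrow> 0"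
    using LIMSEQ_inverse_real_of_nat by (simp add: inverse_eq_divide)
  have "p \<longlonglongrightarrow> s"
    by (rule tendsto_sandwich[of "\<lambda>n. s - 1 / real (Suc n)" _ _ "\<lambda>_. s"])
      (use p less_imp_le[OF p(1)] tendsto_diff[OF tendsto_const inv, of s] in auto)
  then have "filterlim p (at_left s) sequentially"
    unfolding filterlim_at using p(1) by (auto simp: less_imp_neq)
  then have P: "(\<lambda>n. \<omega> (p n)) \<longlonglongrightarrow> l"
    by (rule filterlim_compose[OF l])
  have "q \<longlonglongrightarrow> s"
    by (rule tendsto_sandwich[of "\<lambda>_. s" _ _ "\<lambda>n. s + 1 / real (Suc n)"])
      (use q tendsto_add[OF tendsto_const inv, of s] in auto)
  moreover have "continuous (at s within {s..}) \<omega>"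
    using r by (simp add: continuous_within at_within_Ici_at_right)
  ultimately have Q: "(\<lambda>n. \<omega> (q n)) \<longlonglongrightarrow> \<omega> s"
    using q(1) by (intro continuous_within_tendsto_compose'[of s "{s..}" \<omega>]) auto
  have "0 \<le> \<kappa> * (\<omega> s - l)"
  proof (rule tendsto_le)
    show "(\<lambda>n. \<kappa> * (\<omega> (q n) - \<omega> (p n))) \<longlonglongrightarrow> \<kappa> * (\<omega> s - l)"
      by (intro tendsto_intros P Q)
    show "(\<lambda>n. - (M * (1 / real (Suc n)))) \<longlonglongrightarrow> 0"
      using tendsto_minus[OF tendsto_mult[OF tendsto_const inv, of M]] by simp
    show "\<forall>\<^sub>F n in sequentially. - (M * (1 / real (Suc n))) \<le> \<kappa> * (\<omega> (q n) - \<omega> (p n))"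
      using inc by (auto simp: p_def q_def)
  qed simp
  then show ?thesis by (simp add: jump_eq[OF l])
qed

lemma emeasure_jump_measure_eq_0:
  assumes "E \<in> sets borel" "\<And>s. (s, jump \<omega> s) \<notin> E"
  shows "emeasure (jump_measure \<omega>) E = 0"
proof -
  have "(\<lambda>s. (s, jump \<omega> s)) -` E \<inter> {s. jump \<omega> s \<noteq> 0} = {}" using assms(2) by auto
  then show ?thesis
    using assms(1) unfolding jump_measure_def by (subst emeasure_distr) auto
qed

context levy_process
begin

text \<open>If one increment of length 1/(n+1) went below this bound with probability p > 0, then by
  independence and stationarity all n+1 of them in [0,1] would do so together with probability
  p^(n+1), and their sum would violate the bound on \<omega> 1.\<close>

lemma AE_increment_ge:
  assumes bound: "AE \<omega> in P. - M \<le> \<kappa> * \<omega> 1"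
  shows "AE \<omega> in P. - (M / real (Suc n)) \<le> \<kappa> * (\<omega> (of_int (k + 1) / real (Suc n)) - \<omega> (of_int k / real (Suc n)))"
proof -
  define N where "N = real (Suc n)"
  have "N > 0" by (simp add: N_def)
  define \<tau> where "\<tau> i = real i / N" for i
  have "mono \<tau>" using \<open>N > 0\<close> by (auto simp: \<tau>_def mono_def divide_right_mono)
  define B where "B = {z. \<kappa> * z < - (M / N)}"
  have "B \<in> sets borel"
    unfolding B_def by measurable
  have same: "prob ((\<lambda>\<omega>. \<omega> (s + 1 / N) - \<omega> s) -` B \<inter> paths) = prob ((\<lambda>\<omega>. \<omega> (1 / N) - \<omega> 0) -` B \<inter> paths)" for s
  proof -
    have "measure (distr P borel (\<lambda>\<omega>. \<omega> (1 / N + s) - \<omega> (0 + s))) B = measure (distr P borel (\<lambda>\<omega>. \<omega> (1 / N) - \<omega> 0)) B"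
      by (simp only: stationary_increments)
    then show ?thesis
      using \<open>B \<in> _\<close> by (simp add: measure_distr add.commute)
  qed
  have ev: "{\<omega> \<in> space P. \<not> - M \<le> \<kappa> * \<omega> 1} \<in> events" by measurable
  have "prob {\<omega> \<in> space P. \<not> - M \<le> \<kappa> * \<omega> 1} = 0"
    unfolding prob_Collect_eq_0[OF ev] using bound by simp
  moreover have "(\<Inter>i\<in>{..n}. (\<lambda>\<omega>. increments \<tau> \<omega> i) -` B \<inter> space P) \<subseteq> {\<omega> \<in> paths. \<not> - M \<le> \<kappa> * \<omega> 1}"
  proof safe
    fix \<omega> assume \<omega>: "\<omega> \<in> (\<Inter>i\<in>{..n}. (\<lambda>\<omega>. increments \<tau> \<omega> i) -` B \<inter> space P)"
    then show "\<omega> \<in> paths" by auto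
    assume "- M \<le> \<kappa> * \<omega> 1"
    have "\<omega> 1 = (\<Sum>i\<in>{0..<Suc n}. increments \<tau> \<omega> i)"
      using path_eq_sum_increments(1)[of \<omega> \<tau> 0 "Suc n"] \<open>\<omega> \<in> paths\<close> by (simp add: \<tau>_def N_def del: of_nat_Suc)
    then have "\<kappa> * \<omega> 1 = (\<Sum>i\<in>{0..<Suc n}. \<kappa> * increments \<tau> \<omega> i)"
      by (simp only: sum_distrib_left)
    also have "\<dots> < (\<Sum>i\<in>{0..<Suc n}. - (M / N))"
      using \<omega> by (intro sum_strict_mono) (auto simp: B_def)
    also have "\<dots> = - M" by (simp add: N_def)
    finally show False using \<open>- M \<le> \<kappa> * \<omega> 1\<close> by simp
  qed
  ultimately have "prob (\<Inter>i\<in>{..n}. (\<lambda>\<omega>. increments \<tau> \<omega> i) -` B \<inter> space P) = 0"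
    using finite_measure_mono[of "\<Inter>i\<in>{..n}. (\<lambda>\<omega>. increments \<tau> \<omega> i) -` B \<inter> space P"
        "{\<omega> \<in> space P. \<not> - M \<le> \<kappa> * \<omega> 1}"] ev
    by (simp add: measure_le_0_iff)
  moreover have "prob (\<Inter>i\<in>{..n}. (\<lambda>\<omega>. increments \<tau> \<omega> i) -` B \<inter> space P)
      = (\<Prod>i\<in>{..n}. prob ((\<lambda>\<omega>. increments \<tau> \<omega> i) -` B \<inter> space P))"
    using \<open>B \<in> _\<close> by (intro indep_varsD[OF indep_increments[OF \<open>mono \<tau>\<close>]]) auto
  moreover have "(\<lambda>\<omega>. increments \<tau> \<omega> i) = (\<lambda>\<omega>. \<omega> (\<tau> i + 1 / N) - \<omega> (\<tau> i))" for i
    by (auto simp: increments_def \<tau>_def add_divide_distrib add.commute)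
  ultimately have "prob ((\<lambda>\<omega>. \<omega> (1 / N) - \<omega> 0) -` B \<inter> paths) = 0"
    by (auto simp: same)
  then have "prob ((\<lambda>\<omega>. \<omega> (of_int k / N + 1 / N) - \<omega> (of_int k / N)) -` B \<inter> paths) = 0"
    by (simp add: same)
  moreover have ev': "{\<omega> \<in> space P. \<not> - (M / N) \<le> \<kappa> * (\<omega> (of_int k / N + 1 / N) - \<omega> (of_int k / N))} \<in> events"
    by measurable
  ultimately have "prob {\<omega> \<in> space P. \<not> - (M / N) \<le> \<kappa> * (\<omega> (of_int k / N + 1 / N) - \<omega> (of_int k / N))} = 0"
    by (simp add: B_def vimage_def Int_def conj_commute not_le)
  then have "AE \<omega> in P. - (M / N) \<le> \<kappa> * (\<omega> (of_int k / N + 1 / N) - \<omega> (of_int k / N))"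
    unfolding prob_Collect_eq_0[OF ev'] by simp
  then show ?thesis by (simp add: N_def add_divide_distrib)
qed

text \<open>Otherwise almost surely no jump falls in D, whereas a Poisson variable of mean \<nu>(D),
  positive and finite, vanishes only with probability exp(-\<nu>(D)) < 1.\<close>

lemma unbounded_noise:
  assumes poisson: "poisson_random_measure P jump_measure (lborel \<Otimes>\<^sub>M \<nu>)"
    and \<nu>: "sigma_finite_measure \<nu>" "sets \<nu> = sets borel"
    and D: "D \<in> sets borel" "0 < emeasure \<nu> D" "emeasure \<nu> D < \<infinity>" "\<And>z. z \<in> D \<Longrightarrow> \<kappa> * z < 0"
  shows "0 < prob {\<omega> \<in> paths. \<kappa> * \<omega> 1 < - M}"
proof (rule ccontr)
  assume "\<not> ?thesis"
  have ev: "{\<omega> \<in> space P. \<not> - M \<le> \<kappa> * \<omega> 1} \<in> events" by measurable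
  from \<open>\<not> ?thesis\<close> have "prob {\<omega> \<in> space P. \<not> - M \<le> \<kappa> * \<omega> 1} = 0"
    using measure_nonneg[of P "{\<omega> \<in> paths. \<kappa> * \<omega> 1 < - M}"] by (simp add: not_le)
  then have "AE \<omega> in P. - M \<le> \<kappa> * \<omega> 1"
    unfolding prob_Collect_eq_0[OF ev] by simp
  then have "AE \<omega> in P. \<forall>n k. - (M / real (Suc n)) \<le> \<kappa> * (\<omega> (of_int (k + 1) / real (Suc n)) - \<omega> (of_int k / real (Suc n)))"
    using AE_increment_ge by (simp add: AE_all_countable)
  then have sign: "AE \<omega> in P. \<forall>s. 0 \<le> \<kappa> * jump \<omega> s"
    using AE_space
  proof eventually_elim
    case (elim \<omega>)
    then show ?case using jump_sign[of \<omega> M \<kappa>] by auto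
  qed
  interpret \<nu>: sigma_finite_measure \<nu> by fact
  define E where "E = {0<..1::real} \<times> D"
  have E: "E \<in> sets borel"
    unfolding E_def borel_prod[symmetric] using D by auto
  have mE: "emeasure (lborel \<Otimes>\<^sub>M \<nu>) E = emeasure \<nu> D"
    unfolding E_def using D \<nu> by (subst \<nu>.emeasure_pair_measure_Times) auto
  have zero: "AE \<omega> in P. emeasure (jump_measure \<omega>) E = 0"
    using sign
  proof eventually_elim
    case (elim \<omega>)
    have "(s, jump \<omega> s) \<notin> E" for s
    proof
      assume "(s, jump \<omega> s) \<in> E"
      then have "jump \<omega> s \<in> D" by (simp add: E_def)
      from D(4)[OF this] spec[OF elim, of s] show False by linarith
    qed
    with E show ?case by (rule emeasure_jump_measure_eq_0)
  qed
  have "measure P {\<omega> \<in> space P. emeasure (jump_measure \<omega>) E = of_nat 0}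
      = measure (lborel \<Otimes>\<^sub>M \<nu>) E ^ 0 / fact 0 * exp (- measure (lborel \<Otimes>\<^sub>M \<nu>) E)"
    using conjunct2[OF poisson[unfolded poisson_random_measure_def], rule_format, OF E, of 0] D(3) mE
    by simp
  then have eq: "prob {\<omega> \<in> space P. emeasure (jump_measure \<omega>) E = 0} = exp (- measure \<nu> D)"
    using mE by (simp add: measure_def)
  \<comment> \<open>\<open>measure\<close> is 0 on sets that are not measurable, so the positive
    value in \<open>eq\<close> itself proves measurability.\<close>
  have ev0: "{\<omega> \<in> space P. emeasure (jump_measure \<omega>) E = 0} \<in> events"
  proof (rule ccontr)
    assume "{\<omega> \<in> space P. emeasure (jump_measure \<omega>) E = 0} \<notin> events"
    from measure_notin_sets[OF this] eq show False by simp
  qed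
  have "prob {\<omega> \<in> space P. emeasure (jump_measure \<omega>) E = 0} = 1"
    unfolding prob_Collect_eq_1[OF ev0] by (rule zero)
  moreover have "0 < measure \<nu> D"
    using D(2,3) by (simp add: measure_def enn2real_positive_iff)
  ultimately show False using eq by simp
qed

end

section \<open>Mass of the stable Levy measures on both sides of 0\<close>

lemma stable_const_pos:
  assumes "0 < \<alpha>" "\<alpha> < 2"
  shows "0 < stable_const \<alpha>"
  unfolding stable_const_def using assms
  by (intro mult_pos_pos divide_pos_pos Gamma_real_pos) auto

lemma sigma_finite_stable_measure: "sigma_finite_measure (stable_measure \<alpha>)"
  unfolding stable_measure_def
  by (subst sigma_finite_measure.sigma_finite_iff_density_finite[OF lborel.sigma_finite_measure_axioms]) (auto split: split_indicator simp: ennreal_mult_eq_top_iff)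

lemma sigma_finite_truncated_stable_measure: "sigma_finite_measure (truncated_stable_measure \<alpha>)"
  unfolding truncated_stable_measure_def
  by (subst sigma_finite_measure.sigma_finite_iff_density_finite[OF sigma_finite_stable_measure])
    (auto split: split_indicator simp: stable_measure_def)

text \<open>On the annulus the density is bounded above and below by positive constants. The annulus
  avoids the singularity at 0 and lies in the unit ball, where the truncated and the full measure
  agree.\<close>

lemma stable_measure_annulus:
  assumes "0 < \<alpha>" "\<alpha> < 2" and D: "D \<in> sets borel" "D \<subseteq> {z. 1 / 2 < \<bar>z\<bar> \<and> \<bar>z\<bar> < 1}" "0 < emeasure lborel D"
  shows "0 < emeasure (stable_measure \<alpha>) D" "emeasure (stable_measure \<alpha>) D < \<infinity>"
proof -
  let ?c = "stable_const \<alpha>"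
  have c: "0 < ?c" by (rule stable_const_pos) fact+
  let ?f = "\<lambda>z. ennreal (?c * \<bar>z\<bar> powr (- 1 - \<alpha>)) * indicator (- {0}) z * indicator D z"
  have em: "emeasure (stable_measure \<alpha>) D = (\<integral>\<^sup>+ z. ?f z \<partial>lborel)"
    unfolding stable_measure_def using D by (subst emeasure_density) auto
  have fin: "emeasure lborel D < \<infinity>"
  proof -
    have "emeasure lborel D \<le> emeasure lborel {-1..1::real}"
      using D(2) by (intro emeasure_mono) (auto simp: subset_eq abs_less_iff dest!: bspec)
    then show ?thesis by (simp add: le_less_trans)
  qed
  have "0 < ennreal ?c * emeasure lborel D"
    using c D(3) by (simp add: ennreal_zero_less_mult_iff)
  also have "\<dots> = (\<integral>\<^sup>+ z. ennreal ?c * indicator D z \<partial>lborel)"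
    using D by (simp add: nn_integral_cmult_indicator)
  also have "\<dots> \<le> (\<integral>\<^sup>+ z. ?f z \<partial>lborel)"
  proof (rule nn_integral_mono)
    fix z :: real
    show "ennreal ?c * indicator D z \<le> ?f z"
    proof (cases "z \<in> D")
      case True
      then have z: "1 / 2 < \<bar>z\<bar>" "\<bar>z\<bar> < 1" "z \<noteq> 0" using D(2) by force+
      have "1 \<le> \<bar>z\<bar> powr (- 1 - \<alpha>)"
        using powr_mono2'[of "- 1 - \<alpha>" "\<bar>z\<bar>" 1] z assms by simp
      then have "?c * 1 \<le> ?c * \<bar>z\<bar> powr (- 1 - \<alpha>)" using c by (intro mult_left_mono) auto
      then show ?thesis using True z by (simp add: ennreal_leI)
    qed simp
  qed
  finally show "0 < emeasure (stable_measure \<alpha>) D" by (simp add: em)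
  have "(\<integral>\<^sup>+ z. ?f z \<partial>lborel) \<le> (\<integral>\<^sup>+ z. ennreal (?c * (1 / 2) powr (- 1 - \<alpha>)) * indicator D z \<partial>lborel)"
  proof (rule nn_integral_mono)
    fix z :: real
    show "?f z \<le> ennreal (?c * (1 / 2) powr (- 1 - \<alpha>)) * indicator D z"
    proof (cases "z \<in> D")
      case True
      then have z: "1 / 2 < \<bar>z\<bar>" "z \<noteq> 0" using D(2) by force+
      have "\<bar>z\<bar> powr (- 1 - \<alpha>) \<le> (1 / 2) powr (- 1 - \<alpha>)"
        using powr_mono2'[of "- 1 - \<alpha>" "1 / 2" "\<bar>z\<bar>"] z assms by simp
      then have "?c * \<bar>z\<bar> powr (- 1 - \<alpha>) \<le> ?c * (1 / 2) powr (- 1 - \<alpha>)" using c by (intro mult_left_mono) auto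
      then show ?thesis using True z by (simp add: ennreal_leI)
    qed simp
  qed
  also have "\<dots> = ennreal (?c * (1 / 2) powr (- 1 - \<alpha>)) * emeasure lborel D"
    using D by (simp add: nn_integral_cmult_indicator)
  also have "\<dots> < \<infinity>" using fin by (simp add: ennreal_mult_less_top)
  finally show "emeasure (stable_measure \<alpha>) D < \<infinity>" by (simp add: em)
qed

lemma emeasure_truncated_stable_measure:
  assumes "D \<in> sets borel" "D \<subseteq> {z. 1 / 2 < \<bar>z\<bar> \<and> \<bar>z\<bar> < 1}"
  shows "emeasure (truncated_stable_measure \<alpha>) D = emeasure (stable_measure \<alpha>) D"
proof -
  have "emeasure (truncated_stable_measure \<alpha>) D = emeasure (stable_measure \<alpha>) ({z. \<bar>z\<bar> < 1} \<inter> D)"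
    unfolding truncated_stable_measure_def
    using assms by (intro emeasure_restricted) (auto simp: stable_measure_def)
  moreover have "{z. \<bar>z\<bar> < 1} \<inter> D = D" using assms(2) by auto
  ultimately show ?thesis by simp
qed

lemma stable_noise_unbounded:
  assumes "0 < \<alpha>" "\<alpha> < 2" and noise: "stable_noise \<alpha> P \<or> truncated_stable_noise \<alpha> P" and "\<kappa> \<noteq> 0"
  shows "levy_process P" and "0 < measure P {\<omega> \<in> paths. \<kappa> * \<omega> 1 < - M}"
proof -
  show levy: "levy_process P"
    using noise
    by (auto simp: stable_noise_def truncated_stable_noise_def levy_jump_process_def levy_process_def
        levy_process_axioms_def two_sided_levy_process_def)
  define D where "D = (if 0 < \<kappa> then {- 1<..<- (1 / 2)} else {1 / 2<..<1::real})"
  have "emeasure lborel D = ennreal (1 / 2)"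
    unfolding D_def by (cases "0 < \<kappa>") simp_all
  then have "0 < emeasure lborel D"
    using ennreal_less_zero_iff[of "1 / 2"] by simp
  then have D: "D \<in> sets borel" "D \<subseteq> {z. 1 / 2 < \<bar>z\<bar> \<and> \<bar>z\<bar> < 1}" "0 < emeasure lborel D" "\<And>z. z \<in> D \<Longrightarrow> \<kappa> * z < 0"
    using \<open>\<kappa> \<noteq> 0\<close> by (auto simp: D_def mult_less_0_iff split: if_splits)
  note ann = stable_measure_annulus[OF assms(1,2) D(1-3)]
  from noise show "0 < measure P {\<omega> \<in> paths. \<kappa> * \<omega> 1 < - M}"
  proof
    assume "stable_noise \<alpha> P"
    then show ?thesis
      using ann D
      by (intro levy_process.unbounded_noise[OF levy, of "stable_measure \<alpha>" D] sigma_finite_stable_measure)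
        (auto simp: stable_noise_def levy_jump_process_def stable_measure_def)
  next
    assume "truncated_stable_noise \<alpha> P"
    then show ?thesis
      using ann D
      by (intro levy_process.unbounded_noise[OF levy, of "truncated_stable_measure \<alpha>" D] sigma_finite_truncated_stable_measure)
        (auto simp: truncated_stable_noise_def levy_jump_process_def emeasure_truncated_stable_measure,
         auto simp: truncated_stable_measure_def stable_measure_def)
  qed
qed

section \<open>Coincidence of the pullback limits\<close>

text \<open>Allowing \<kappa> of either sign in \<open>unbounded\<close> makes the locale invariant
  under reflection, so that pushing below 0 and pushing above 0 are one result.\<close>

locale driven_flow = cubic_flow \<beta> \<sigma> \<phi> + levy_process P
  for \<beta> \<sigma> :: real and \<phi> :: cocycle and P :: "(real \<Rightarrow> real) measure" +
  assumes unbounded: "\<And>\<kappa> M. \<kappa> \<noteq> 0 \<Longrightarrow> 0 < prob {\<omega> \<in> paths. \<kappa> * \<omega> 1 < - M}"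
    and \<sigma>_nonzero: "\<sigma> \<noteq> 0"
begin

lemma driven_flow_reflect: "driven_flow \<beta> (- \<sigma>) (reflect \<phi>) P"
  using cubic_flow_reflect levy_process_axioms unbounded \<sigma>_nonzero
  by (auto simp: driven_flow_def driven_flow_axioms_def)

lemma prob_past_future:
  assumes "A \<in> sets path_space" "B \<in> sets path_space"
    and "\<And>\<omega>. \<omega> \<in> paths \<Longrightarrow> past_part \<omega> \<in> A \<longleftrightarrow> \<omega> \<in> A"
    and "\<And>\<omega>. \<omega> \<in> paths \<Longrightarrow> future_part \<omega> \<in> B \<longleftrightarrow> \<omega> \<in> B"
  shows "prob (A \<inter> B) = prob A * prob B"
proof -
  have sub: "A \<subseteq> paths" "B \<subseteq> paths" using assms(1,2) sets.sets_into_space by force+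
  have "past_part -` A \<inter> paths = A" "future_part -` B \<inter> paths = B"
    "(\<lambda>\<omega>. (past_part \<omega>, future_part \<omega>)) -` (A \<times> B) \<inter> paths = A \<inter> B"
    using assms(3,4) sub by auto
  then show ?thesis
    using indep_varD[OF indep_past_future assms(1,2)] by simp
qed

lemma prob_shift:
  assumes "A \<in> sets path_space"
  shows "prob (shift t -` A \<inter> paths) = prob A"
proof -
  have "measure (distr P P (shift t)) A = prob (shift t -` A \<inter> paths)"
    using assms by (subst measure_distr) (auto simp: sets_eq measurable_cong_sets[OF refl sets_eq])
  then show ?thesis by (simp add: distr_shift)
qed

definition pushed_below :: "real \<Rightarrow> (real \<Rightarrow> real) set" where
  "pushed_below t = {\<omega> \<in> paths. \<forall>k::nat. \<phi> t \<omega> (real k) \<le> 0}"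

lemma pushed_below_sets: "0 \<le> t \<Longrightarrow> pushed_below t \<in> sets path_space"
  unfolding pushed_below_def space_path_space[symmetric] by measurable

lemma pushed_below_iff:
  assumes "0 \<le> t"
  shows "\<omega> \<in> pushed_below t \<longleftrightarrow> \<omega> \<in> paths \<and> (\<forall>x. \<phi> t \<omega> x \<le> 0)"
proof -
  have "\<phi> t \<omega> x \<le> 0" if "\<omega> \<in> paths" "\<forall>k::nat. \<phi> t \<omega> (real k) \<le> 0" for x
  proof -
    obtain k :: nat where "x \<le> real k" using real_arch_simple by blast
    then have "\<phi> t \<omega> x \<le> \<phi> t \<omega> (real k)" using that assms by (intro mono_flow)
    then show ?thesis using that by (meson order_trans)
  qed
  then show ?thesis by (auto simp: pushed_below_def)
qed

lemma pushed_below_future_part: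
  assumes "\<omega> \<in> paths" "0 \<le> t"
  shows "future_part \<omega> \<in> pushed_below t \<longleftrightarrow> \<omega> \<in> pushed_below t"
  using assms by (simp add: pushed_below_def flow_future_part)

text \<open>After time \<open>1\<close> all solutions lie below some level \<open>R\<close> with positive probability, and the
  independent subsequent noise takes \<open>R\<close> below \<open>0\<close> with positive probability.\<close>

lemma prob_pushed_below_pos: "\<exists>t\<ge>0. 0 < prob (pushed_below t)"
proof -
  define A where "A R = {\<omega> \<in> space path_space. upper 1 \<omega> \<le> real R}" for R :: nat
  have A: "A R \<in> sets path_space" for R
    unfolding A_def using measurable_upper[of 1] by measurable
  \<comment> \<open>\<open>upper 1\<close> is real-valued, so these countably many events cover the
    whole space.\<close>
  have "\<exists>R. 0 < prob (A R)"
  proof (rule ccontr)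
    assume "\<not> ?thesis"
    then have "A R \<in> null_sets P" for R
      using A by (auto simp: null_sets_def sets_eq emeasure_eq_measure not_less measure_le_0_iff)
    then have "(\<Union>R. A R) \<in> null_sets P" by (rule null_sets_UN)
    moreover have "(\<Union>R. A R) = space P"
      by (auto simp: A_def real_arch_simple)
    ultimately show False using emeasure_space_1 by (simp add: null_sets_def)
  qed
  then obtain R where R: "0 < prob (A R)" ..
  define B where "B q = {\<omega> \<in> space path_space. \<phi> q \<omega> (real R) < 0}" for q
  have B: "B q \<in> sets path_space" if "0 \<le> q" for q
    unfolding B_def using that by measurable
  \<comment> \<open>The crossing time from \<open>hits_negative\<close> depends on the path; as the
    candidates are countable, one fixed time has positive probability.\<close>
  have "\<exists>q\<in>\<rat> \<inter> {0..1}. 0 < prob (B q)"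
  proof (rule ccontr)
    assume "\<not> ?thesis"
    then have "B q \<in> null_sets P" if "q \<in> \<rat> \<inter> {0..1}" for q
      using B[of q] that by (auto simp: null_sets_def sets_eq emeasure_eq_measure not_less measure_le_0_iff)
    then have "(\<Union>q\<in>\<rat> \<inter> {0..1}. B q) \<in> null_sets P"
      using countable_rat by (intro null_sets_UN') auto
    moreover have "{\<omega> \<in> paths. \<sigma> * \<omega> 1 < - (real R + \<bar>\<beta>\<bar> * (\<bar>\<beta>\<bar> + 1))} \<subseteq> (\<Union>q\<in>\<rat> \<inter> {0..1}. B q)"
      using hits_negative by (auto simp: B_def)
    ultimately have "prob {\<omega> \<in> paths. \<sigma> * \<omega> 1 < - (real R + \<bar>\<beta>\<bar> * (\<bar>\<beta>\<bar> + 1))} \<le> 0"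
      using finite_measure_mono[of _ "\<Union>q\<in>\<rat> \<inter> {0..1}. B q"] by (auto simp: null_sets_def measure_def)
    then show False using unbounded[OF \<sigma>_nonzero, of "real R + \<bar>\<beta>\<bar> * (\<bar>\<beta>\<bar> + 1)"] by simp
  qed
  then obtain q where q: "0 \<le> q" "0 < prob (B q)" by auto
  \<comment> \<open>\<open>A R\<close> concerns the noise on [-1,0] and \<open>B q\<close> that on
    [0,q]. Together they push everything below 0 over [-1,q], and stationarity moves this interval
    to [0,1+q].\<close>
  have "0 < prob (A R) * prob (B q)" using R q by simp
  also have "\<dots> = prob (A R \<inter> B q)"
    using A B[OF q(1)] upper_past_part[of _ 1] flow_future_part[OF _ q(1)]
    by (intro prob_past_future[symmetric]) (simp_all add: A_def B_def)
  also have "\<dots> \<le> prob (shift (- 1) -` pushed_below (1 + q) \<inter> paths)"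
  proof (rule finite_measure_mono)
    show "A R \<inter> B q \<subseteq> shift (- 1) -` pushed_below (1 + q) \<inter> paths"
    proof
      fix \<omega> assume "\<omega> \<in> A R \<inter> B q"
      then have \<omega>: "\<omega> \<in> paths" "upper 1 \<omega> \<le> real R" "\<phi> q \<omega> (real R) < 0"
        by (auto simp: A_def B_def)
      have "\<phi> (1 + q) (shift (- 1) \<omega>) x \<le> 0" for x
      proof -
        have "\<phi> (1 + q) (shift (- 1) \<omega>) x = \<phi> q \<omega> (\<phi> 1 (shift (- 1) \<omega>) x)"
          using cocycle[of "shift (- 1) \<omega>" 1 q x] \<omega> q by simp
        also have "\<dots> \<le> \<phi> q \<omega> (real R)"
          using flow_le_upper[of \<omega> 1 x] \<omega> q by (intro mono_flow) auto
        finally show ?thesis using \<omega> by simp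
      qed
      then show "\<omega> \<in> shift (- 1) -` pushed_below (1 + q) \<inter> paths"
        using \<omega> q by (simp add: pushed_below_iff)
    qed
    show "shift (- 1) -` pushed_below (1 + q) \<inter> paths \<in> events"
      using measurable_sets[OF measurable_shift pushed_below_sets[of "1 + q"]] q by (simp add: sets_eq)
  qed
  also have "\<dots> = prob (pushed_below (1 + q))"
    using q by (intro prob_shift pushed_below_sets) auto
  finally show ?thesis using q by (intro exI[of _ "1 + q"]) auto
qed

text \<open>The mixed inequalities say that {x. x \<le> c} contains the lower limit but not the
  upper one. Pulled back through a flow map, this keeps its form by
  \<open>flow_sublevel\<close>.\<close>

definition straddle :: "real \<Rightarrow> (real \<Rightarrow> real) set" where
  "straddle c = {\<omega> \<in> paths. lower_limit \<omega> \<le> c \<and> c < upper_limit \<omega>}"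

lemma straddle_sets: "straddle c \<in> sets path_space"
  unfolding straddle_def space_path_space[symmetric] by measurable

text \<open>Under the flow over \<open>[0,t]\<close>, the pair of limits straddles \<open>c\<close> iff at time \<open>0\<close> it straddled the
  right end of \<open>{x. \<phi> t \<omega> x \<le> c}\<close>, which depends only on the future noise; on \<open>S\<close> there is no such end.\<close>

lemma prob_straddle_contraction:
  assumes "0 \<le> t" and S: "S \<in> sets path_space" "\<And>\<omega>. \<omega> \<in> paths \<Longrightarrow> future_part \<omega> \<in> S \<longleftrightarrow> \<omega> \<in> S"
    and triv: "\<And>\<omega>. \<omega> \<in> S \<Longrightarrow> {x. \<phi> t \<omega> x \<le> c} = {} \<or> {x. \<phi> t \<omega> x \<le> c} = UNIV"
    and \<Delta>: "\<And>z. prob (straddle z) \<le> \<Delta>"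
  shows "prob (straddle c) \<le> (1 - prob S) * \<Delta>"
proof -
  have "0 \<le> \<Delta>" using \<Delta>[of 0] measure_nonneg[of P "straddle 0"] by linarith
  define Q1 where "Q1 = distr P path_space past_part"
  define Q2 where "Q2 = distr P path_space future_part"
  interpret Q1: prob_space Q1 unfolding Q1_def by (rule prob_space_distr) simp
  interpret Q2: prob_space Q2 unfolding Q2_def by (rule prob_space_distr) simp
  interpret Q: pair_sigma_finite Q1 Q2 ..
  \<comment> \<open>By equivariance and stationarity, straddling c at time t is an event of the
    independent pair of past and future parts: the limits use the first, the flow map the
    second.\<close>
  define W where "W = {p \<in> space (path_space \<Otimes>\<^sub>M path_space).
      \<phi> t (snd p) (lower_limit (fst p)) \<le> c \<and> c < \<phi> t (snd p) (upper_limit (fst p))}"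
  have W: "W \<in> sets (path_space \<Otimes>\<^sub>M path_space)"
    unfolding W_def using \<open>0 \<le> t\<close> by measurable
  have "emeasure P (straddle c) = emeasure P (shift t -` straddle c \<inter> paths)"
    using prob_shift[OF straddle_sets, of t c] by (simp add: emeasure_eq_measure)
  also have "shift t -` straddle c \<inter> paths = (\<lambda>\<omega>. (past_part \<omega>, future_part \<omega>)) -` W \<inter> space P"
    using \<open>0 \<le> t\<close>
    by (auto simp: straddle_def W_def space_pair_measure upper_limit_shift lower_limit_shift
        flow_future_part upper_limit_past_part lower_limit_past_part)
  also have "emeasure P \<dots> = emeasure (distr P (path_space \<Otimes>\<^sub>M path_space) (\<lambda>\<omega>. (past_part \<omega>, future_part \<omega>))) W"
    using W by (subst emeasure_distr) auto
  also have "distr P (path_space \<Otimes>\<^sub>M path_space) (\<lambda>\<omega>. (past_part \<omega>, future_part \<omega>)) = Q1 \<Otimes>\<^sub>M Q2"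
    unfolding Q1_def Q2_def using indep_past_future by (simp add: indep_var_distribution_eq)
  also have "emeasure (Q1 \<Otimes>\<^sub>M Q2) W = (\<integral>\<^sup>+ \<eta>. emeasure Q1 ((\<lambda>\<omega>. (\<omega>, \<eta>)) -` W) \<partial>Q2)"
    using W by (intro Q.emeasure_pair_measure_alt2) (simp add: Q1_def Q2_def cong: sets_pair_measure_cong)
  also have "\<dots> \<le> (\<integral>\<^sup>+ \<eta>. ennreal \<Delta> * indicator (paths - S) \<eta> \<partial>Q2)"
  proof (rule nn_integral_mono)
    fix \<eta> assume "\<eta> \<in> space Q2"
    then have \<eta>: "\<eta> \<in> paths" by (simp add: Q2_def)
    have sec: "(\<lambda>\<omega>. (\<omega>, \<eta>)) -` W = {\<omega> \<in> paths. lower_limit \<omega> \<in> {x. \<phi> t \<eta> x \<le> c} \<and> upper_limit \<omega> \<notin> {x. \<phi> t \<eta> x \<le> c}}"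
      using \<eta> by (auto simp: W_def space_pair_measure)
    \<comment> \<open>With the future \<eta> frozen the pulled-back level z is deterministic, and
      the section is \<open>straddle z\<close>, an event of the past.\<close>
    consider "{x. \<phi> t \<eta> x \<le> c} = {} \<or> {x. \<phi> t \<eta> x \<le> c} = UNIV"
      | z where "\<eta> \<notin> S" "{x. \<phi> t \<eta> x \<le> c} = {..z}"
      using flow_sublevel[OF \<eta> \<open>0 \<le> t\<close>, of c] triv[of \<eta>] by blast
    then show "emeasure Q1 ((\<lambda>\<omega>. (\<omega>, \<eta>)) -` W) \<le> ennreal \<Delta> * indicator (paths - S) \<eta>"
    proof cases
      case 1
      then have "(\<lambda>\<omega>. (\<omega>, \<eta>)) -` W = {}" unfolding sec by auto
      then show ?thesis by simp
    next
      case (2 z)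
      have "(\<lambda>\<omega>. (\<omega>, \<eta>)) -` W = straddle z"
        unfolding sec 2(2) straddle_def by auto
      moreover have "past_part -` straddle z \<inter> space P = straddle z"
        by (auto simp: straddle_def upper_limit_past_part lower_limit_past_part)
      ultimately have "emeasure Q1 ((\<lambda>\<omega>. (\<omega>, \<eta>)) -` W) = emeasure P (straddle z)"
        unfolding Q1_def using straddle_sets by (simp add: emeasure_distr)
      also have "\<dots> \<le> ennreal \<Delta>"
        using \<Delta> by (simp add: emeasure_eq_measure ennreal_leI)
      finally show ?thesis using 2 \<eta> by simp
    qed
  qed
  also have "\<dots> = ennreal \<Delta> * emeasure Q2 (paths - S)"
    using S sets.compl_sets[OF S(1)] by (intro nn_integral_cmult_indicator) (simp add: Q2_def)
  also have "emeasure Q2 (paths - S) = emeasure P (space P - S)"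
  proof -
    have "future_part -` (paths - S) \<inter> space P = space P - S"
      using S(2) by auto
    then show ?thesis
      unfolding Q2_def using sets.compl_sets[OF S(1)] by (subst emeasure_distr) auto
  qed
  also have "ennreal \<Delta> * emeasure P (space P - S) = ennreal ((1 - prob S) * \<Delta>)"
    using S(1) \<open>0 \<le> \<Delta>\<close> by (subst emeasure_eq_measure, subst prob_compl) (auto simp: sets_eq ennreal_mult' mult.commute)
  finally show ?thesis
    using \<open>0 \<le> \<Delta>\<close> by (subst (asm) emeasure_eq_measure) (simp add: ennreal_le_iff)
qed

lemma AE_limits_eq: "AE \<omega> in P. lower_limit \<omega> = upper_limit \<omega>"
proof -
  obtain t where t: "0 \<le> t" "0 < prob (pushed_below t)"
    using prob_pushed_below_pos by blast
  interpret r: driven_flow \<beta> "- \<sigma>" "reflect \<phi>" P by (rule driven_flow_reflect)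
  obtain t' where t': "0 \<le> t'" "0 < prob (r.pushed_below t')"
    using r.prob_pushed_below_pos by blast
  define \<delta> where "\<delta> = min (prob (pushed_below t)) (prob (r.pushed_below t'))"
  have "0 < \<delta>" using t t' by (simp add: \<delta>_def)
  define \<Delta> where "\<Delta> = (SUP c. prob (straddle c))"
  have \<Delta>: "prob (straddle c) \<le> \<Delta>" for c
    unfolding \<Delta>_def by (rule cSUP_upper) (auto intro!: bdd_aboveI[of _ 1])
  then have "0 \<le> \<Delta>" using measure_nonneg[of P "straddle 0"] order_trans by blast
  \<comment> \<open>For c \<ge> 0, pushing everything below 0 makes the sublevel set the whole line;
    for c < 0, pushing everything above 0 makes it empty. The minimum \<delta> serves both
    cases.\<close>
  have "prob (straddle c) \<le> (1 - \<delta>) * \<Delta>" for c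
  proof (cases "0 \<le> c")
    case True
    have "prob (straddle c) \<le> (1 - prob (pushed_below t)) * \<Delta>"
    proof (rule prob_straddle_contraction[OF t(1) pushed_below_sets[OF t(1)] pushed_below_future_part[OF _ t(1)] _ \<Delta>])
      fix \<omega> assume "\<omega> \<in> pushed_below t"
      then have "\<phi> t \<omega> x \<le> c" for x
        using True by (auto simp: pushed_below_iff[OF t(1)] intro: order_trans)
      then show "{x. \<phi> t \<omega> x \<le> c} = {} \<or> {x. \<phi> t \<omega> x \<le> c} = UNIV" by auto
    qed
    also have "\<dots> \<le> (1 - \<delta>) * \<Delta>" using \<open>0 \<le> \<Delta>\<close> by (intro mult_right_mono) (auto simp: \<delta>_def)
    finally show ?thesis .
  next
    case False
    have "prob (straddle c) \<le> (1 - prob (r.pushed_below t')) * \<Delta>"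
    proof (rule prob_straddle_contraction[OF t'(1) r.pushed_below_sets[OF t'(1)] r.pushed_below_future_part[OF _ t'(1)] _ \<Delta>])
      fix \<omega> assume "\<omega> \<in> r.pushed_below t'"
      then have "reflect \<phi> t' \<omega> (- x) \<le> 0" for x
        by (simp add: r.pushed_below_iff[OF t'(1)])
      then have "c < \<phi> t' \<omega> x" for x
        using False by (simp add: reflect_def not_le) (meson less_le_trans)
      then show "{x. \<phi> t' \<omega> x \<le> c} = {} \<or> {x. \<phi> t' \<omega> x \<le> c} = UNIV" by (auto simp: not_le)
    qed
    also have "\<dots> \<le> (1 - \<delta>) * \<Delta>" using \<open>0 \<le> \<Delta>\<close> by (intro mult_right_mono) (auto simp: \<delta>_def)
    finally show ?thesis .
  qed
  then have "\<Delta> \<le> (1 - \<delta>) * \<Delta>"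
    unfolding \<Delta>_def by (intro cSUP_least) auto
  then have "\<delta> * \<Delta> \<le> 0" by (simp add: left_diff_distrib)
  then have "\<Delta> \<le> 0" using \<open>0 < \<delta>\<close> by (simp add: mult_le_0_iff)
  then have "prob (straddle c) = 0" for c
    using \<Delta>[of c] measure_nonneg[of P "straddle c"] by linarith
  then have null: "straddle c \<in> null_sets P" for c
    using straddle_sets by (simp add: null_sets_def sets_eq emeasure_eq_measure)
  \<comment> \<open>Two different limits are separated by a rational level, so countably many null
    sets suffice.\<close>
  have "AE \<omega> in P. \<forall>c\<in>\<rat>. \<omega> \<notin> straddle c"
    unfolding AE_ball_countable[OF countable_rat] using AE_not_in[OF null] by blast
  then show ?thesis
    using AE_space
  proof eventually_elim
    case (elim \<omega>)
    have "\<not> lower_limit \<omega> < upper_limit \<omega>"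
    proof
      assume "lower_limit \<omega> < upper_limit \<omega>"
      then obtain c where "c \<in> \<rat>" "lower_limit \<omega> < c" "c < upper_limit \<omega>"
        using Rats_dense_in_real by blast
      with elim show False by (auto simp: straddle_def)
    qed
    with lower_limit_le_upper_limit[of \<omega>] elim show ?case by simp
  qed
qed

end

section \<open>Attractor and invariant measure\<close>

context driven_flow
begin

lemma random_attractor_upper_limit: "random_attractor P \<phi> (\<lambda>\<omega>. {upper_limit \<omega>})"
proof -
  have dist: "set_dist x {y} = ennreal \<bar>x - y\<bar>" for x y
    by (simp add: set_dist_def)
  have "compact_random_set P (\<lambda>\<omega>. {upper_limit \<omega>})"
    unfolding compact_random_set_def dist by simp
  moreover have "AE \<omega> in P.
      (\<forall>t>0. \<phi> t \<omega> ` {upper_limit \<omega>} = {upper_limit (shift t \<omega>)}) \<and>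
      (\<forall>B. bounded B \<longrightarrow>
        ((\<lambda>t. semi_dist (\<phi> t (shift (- t) \<omega>) ` B) {upper_limit \<omega>}) \<longlongrightarrow> 0) at_top)"
    using AE_limits_eq AE_space
  proof eventually_elim
    case (elim \<omega>)
    then have \<omega>: "\<omega> \<in> paths" by simp
    have "((\<lambda>t. upper t \<omega> - lower t \<omega>) \<longlongrightarrow> 0) at_top"
      using tendsto_diff[OF upper_tendsto[OF \<omega>] lower_tendsto[OF \<omega>]] elim by simp
    then have lim: "((\<lambda>t. ennreal (upper t \<omega> - lower t \<omega>)) \<longlongrightarrow> 0) at_top"
      using tendsto_ennrealI by fastforce
    \<comment> \<open>The image of B and the limit both lie between \<open>lower t \<omega>\<close>
      and \<open>upper t \<omega>\<close>, so the length of this interval bounds the distance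
      uniformly in B.\<close>
    have bound: "semi_dist (\<phi> t (shift (- t) \<omega>) ` B) {upper_limit \<omega>} \<le> ennreal (upper t \<omega> - lower t \<omega>)"
      if "0 < t" for t and B :: "real set"
      unfolding semi_dist_def dist
    proof (intro SUP_least ennreal_leI, elim imageE, hypsubst)
      fix x
      show "\<bar>\<phi> t (shift (- t) \<omega>) x - upper_limit \<omega>\<bar> \<le> upper t \<omega> - lower t \<omega>"
        using lower_le_flow[OF \<omega> that, of x] flow_le_upper[OF \<omega> that, of x]
          upper_limit_le_upper[OF \<omega> that] lower_le_lower_limit[OF \<omega> that] elim
        by linarith
    qed
    have "((\<lambda>t. semi_dist (\<phi> t (shift (- t) \<omega>) ` B) {upper_limit \<omega>}) \<longlongrightarrow> 0) at_top" for B :: "real set"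
      by (rule tendsto_sandwich[OF _ _ tendsto_const lim])
        (auto intro: eventually_mono[OF eventually_gt_at_top[of 0]] bound)
    then show ?case using upper_limit_shift[OF \<omega>] by simp
  qed
  ultimately show ?thesis by (simp add: random_attractor_def)
qed

section \<open>The invariant measure on the graph of the limit\<close>

definition graph_measure :: "((real \<Rightarrow> real) \<times> real) measure" where
  "graph_measure = distr P (P \<Otimes>\<^sub>M borel) (\<lambda>\<omega>. (\<omega>, upper_limit \<omega>))"

lemma measurable_graph: "(\<lambda>\<omega>. (\<omega>, upper_limit \<omega>)) \<in> measurable P (P \<Otimes>\<^sub>M borel)"
  by (intro measurable_Pair measurable_ident) (simp_all add: measurable_upper_limit)

lemma sets_pair_P: "sets (P \<Otimes>\<^sub>M borel) = sets (path_space \<Otimes>\<^sub>M borel)"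
  by (intro sets_pair_measure_cong sets_eq refl)

lemma measurable_skew_product:
  assumes "0 \<le> t"
  shows "skew_product \<phi> t \<in> measurable (P \<Otimes>\<^sub>M borel) (P \<Otimes>\<^sub>M borel)"
proof -
  have "(\<lambda>p. (shift t (fst p), \<phi> t (fst p) (snd p))) \<in> measurable (path_space \<Otimes>\<^sub>M borel) (path_space \<Otimes>\<^sub>M borel)"
    using assms by measurable
  then show ?thesis
    by (simp add: skew_product_def split_beta' measurable_cong_sets[OF sets_pair_P sets_pair_P])
qed

text \<open>By equivariance, the graph map followed by the skew product equals the shift followed by
  the graph map, and the shift preserves P.\<close>

lemma invariant_graph_measure: "invariant_measure P \<phi> graph_measure"
  unfolding invariant_measure_def
proof (intro conjI allI impI)
  show "prob_space graph_measure"
    unfolding graph_measure_def by (rule prob_space_distr[OF measurable_graph])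
  show sets: "sets graph_measure = sets (P \<Otimes>\<^sub>M borel)"
    by (simp add: graph_measure_def)
  show "distr graph_measure P fst = P"
    unfolding graph_measure_def
    by (subst distr_distr[OF measurable_fst measurable_graph]) (simp add: comp_def distr_id)
  fix t :: real assume "0 \<le> t"
  have sh: "shift t \<in> measurable P P"
    by (simp add: measurable_cong_sets[OF refl sets_eq])
  have "distr graph_measure graph_measure (skew_product \<phi> t) = distr graph_measure (P \<Otimes>\<^sub>M borel) (skew_product \<phi> t)"
    by (intro distr_cong sets) auto
  also have "\<dots> = distr P (P \<Otimes>\<^sub>M borel) (skew_product \<phi> t \<circ> (\<lambda>\<omega>. (\<omega>, upper_limit \<omega>)))"
    unfolding graph_measure_def by (rule distr_distr[OF measurable_skew_product[OF \<open>0 \<le> t\<close>] measurable_graph])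
  also have "\<dots> = distr P (P \<Otimes>\<^sub>M borel) ((\<lambda>\<omega>. (\<omega>, upper_limit \<omega>)) \<circ> shift t)"
    using \<open>0 \<le> t\<close> by (intro distr_cong) (auto simp: skew_product_def upper_limit_shift)
  also have "\<dots> = distr (distr P P (shift t)) (P \<Otimes>\<^sub>M borel) (\<lambda>\<omega>. (\<omega>, upper_limit \<omega>))"
    by (rule distr_distr[OF measurable_graph sh, symmetric])
  also have "\<dots> = graph_measure"
    by (simp add: distr_shift graph_measure_def)
  finally show "distr graph_measure graph_measure (skew_product \<phi> t) = graph_measure" .
qed

lemma disintegration_graph_measure: "is_disintegration P graph_measure (\<lambda>\<omega>. return borel (upper_limit \<omega>))"
  unfolding is_disintegration_def
proof (intro conjI ballI)
  show "(\<lambda>\<omega>. return borel (upper_limit \<omega>)) \<in> measurable P (prob_algebra borel)"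
    by (intro measurable_compose[OF _ measurable_return_prob_space]) simp
  fix E assume E: "E \<in> sets (P \<Otimes>\<^sub>M (borel :: real measure))"
  have ev: "(\<lambda>\<omega>. (\<omega>, upper_limit \<omega>)) -` E \<inter> space P \<in> sets P"
    by (rule measurable_sets[OF measurable_graph E])
  have "emeasure graph_measure E = emeasure P ((\<lambda>\<omega>. (\<omega>, upper_limit \<omega>)) -` E \<inter> space P)"
    unfolding graph_measure_def by (rule emeasure_distr[OF measurable_graph E])
  also have "\<dots> = (\<integral>\<^sup>+ \<omega>. indicator ((\<lambda>\<omega>. (\<omega>, upper_limit \<omega>)) -` E \<inter> space P) \<omega> \<partial>P)"
    by (rule nn_integral_indicator[OF ev, symmetric])
  also have "\<dots> = (\<integral>\<^sup>+ \<omega>. emeasure (return borel (upper_limit \<omega>)) (Pair \<omega> -` E) \<partial>P)"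
    using sets_Pair1[OF E] by (intro nn_integral_cong) (auto split: split_indicator)
  finally show "emeasure graph_measure E = (\<integral>\<^sup>+ \<omega>. emeasure (return borel (upper_limit \<omega>)) (Pair \<omega> -` E) \<partial>P)" .
qed

lemma markov_graph_measure: "markov_measure P \<phi> graph_measure"
proof -
  have "(\<lambda>\<omega>. return borel (upper_limit \<omega>)) \<in> measurable past (prob_algebra borel)"
    by (rule measurable_compose[OF measurable_upper_limit_past measurable_return_prob_space])
  with invariant_graph_measure disintegration_graph_measure show ?thesis
    unfolding markov_measure_def by (intro conjI exI[of _ "\<lambda>\<omega>. return borel (upper_limit \<omega>)"] bexI) auto
qed

text \<open>The skew product maps every point into the region between \<open>lower t\<close> and \<open>upper t\<close>, so every
  invariant measure is carried by that region for all \<open>t\<close>, hence by the graph of the limit.\<close>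

lemma invariant_measure_unique:
  assumes "invariant_measure P \<phi> \<mu>"
  shows "\<mu> = graph_measure"
proof -
  interpret \<mu>: prob_space \<mu> using assms by (simp add: invariant_measure_def)
  have sets: "sets \<mu> = sets (P \<Otimes>\<^sub>M borel)" and marginal: "distr \<mu> P fst = P"
    and inv: "\<And>t. 0 \<le> t \<Longrightarrow> distr \<mu> \<mu> (skew_product \<phi> t) = \<mu>"
    using assms by (simp_all add: invariant_measure_def)
  have space: "space \<mu> = paths \<times> UNIV"
    using sets_eq_imp_space_eq[OF sets] by (simp add: space_pair_measure)
  have sk: "skew_product \<phi> t \<in> measurable \<mu> \<mu>" if "0 \<le> t" for t
    using measurable_skew_product[OF that] by (simp add: measurable_cong_sets[OF sets sets])
  have fst: "fst \<in> measurable \<mu> P"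
    unfolding measurable_cong_sets[OF sets refl] by (rule measurable_fst)
  have between: "AE p in \<mu>. lower (real (Suc n)) (fst p) \<le> snd p \<and> snd p \<le> upper (real (Suc n)) (fst p)" for n
  proof -
    interpret r: cubic_flow \<beta> "- \<sigma>" "reflect \<phi>" by (rule cubic_flow_reflect)
    let ?t = "real (Suc n)"
    have "lower ?t = (\<lambda>\<omega>. - r.upper ?t \<omega>)"
      by (rule ext) (rule lower_def)
    then have low: "lower ?t \<in> borel_measurable path_space"
      using borel_measurable_uminus[OF r.measurable_upper[of ?t]] by simp
    have "{p \<in> space (path_space \<Otimes>\<^sub>M borel). lower ?t (fst p) \<le> snd p \<and> snd p \<le> upper ?t (fst p)} \<in> sets (path_space \<Otimes>\<^sub>M borel)"
      using low measurable_upper[of ?t] by measurable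
    then have ev: "{p \<in> space \<mu>. lower ?t (fst p) \<le> snd p \<and> snd p \<le> upper ?t (fst p)} \<in> sets \<mu>"
      by (simp only: sets sets_pair_P trans[OF sets_eq_imp_space_eq[OF sets] sets_eq_imp_space_eq[OF sets_pair_P]])
    have "AE p in distr \<mu> \<mu> (skew_product \<phi> ?t). lower ?t (fst p) \<le> snd p \<and> snd p \<le> upper ?t (fst p)"
      unfolding AE_distr_iff[OF sk[OF of_nat_0_le_iff] ev]
      using lower_shift_le_flow[of _ ?t] flow_le_upper_shift[of _ ?t]
      by (intro AE_I2) (auto simp: skew_product_def space simp del: of_nat_Suc)
    then show ?thesis by (simp only: inv[OF of_nat_0_le_iff])
  qed
  \<comment> \<open>The first marginal of \<mu> is P, so the almost sure equality of the limits
    transfers to \<mu>.\<close>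
  have "AE \<omega> in distr \<mu> P fst. lower_limit \<omega> = upper_limit \<omega>"
    unfolding marginal by (rule AE_limits_eq)
  then have eq: "AE p in \<mu>. lower_limit (fst p) = upper_limit (fst p)"
    by (rule AE_distrD[OF fst])
  have between': "AE p in \<mu>. \<forall>n. lower (real (Suc n)) (fst p) \<le> snd p \<and> snd p \<le> upper (real (Suc n)) (fst p)"
    unfolding AE_all_countable using between by blast
  have graph: "AE p in \<mu>. p = (fst p, upper_limit (fst p))"
    using eq AE_space between'
  proof eventually_elim
    case (elim p)
    then have \<omega>: "fst p \<in> paths" by (auto simp: space)
    have nat: "filterlim (\<lambda>n. real (Suc n)) at_top sequentially"
      by (intro filterlim_compose[OF filterlim_real_sequentially] filterlim_Suc)
    have "snd p \<le> upper_limit (fst p)"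
      using elim by (intro tendsto_lowerbound[OF filterlim_compose[OF upper_tendsto[OF \<omega>] nat]]) auto
    moreover have "lower_limit (fst p) \<le> snd p"
      using elim by (intro tendsto_upperbound[OF filterlim_compose[OF lower_tendsto[OF \<omega>] nat]]) auto
    ultimately show ?case using elim by (simp add: prod_eq_iff)
  qed
  \<comment> \<open>A measure carried by a graph is determined by its marginal: projecting and then
    applying the graph map is the identity almost everywhere for \<mu>.\<close>
  have "graph_measure = distr (distr \<mu> P fst) (P \<Otimes>\<^sub>M borel) (\<lambda>\<omega>. (\<omega>, upper_limit \<omega>))"
    by (simp add: graph_measure_def marginal)
  also have "\<dots> = distr \<mu> (P \<Otimes>\<^sub>M borel) ((\<lambda>\<omega>. (\<omega>, upper_limit \<omega>)) \<circ> fst)"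
    by (rule distr_distr[OF measurable_graph fst])
  also have "\<dots> = distr \<mu> (P \<Otimes>\<^sub>M borel) (\<lambda>p. p)"
  proof (rule distr_cong_AE)
    show "AE p in \<mu>. ((\<lambda>\<omega>. (\<omega>, upper_limit \<omega>)) \<circ> fst) p = p"
      using graph by eventually_elim simp
    show "(\<lambda>\<omega>. (\<omega>, upper_limit \<omega>)) \<circ> fst \<in> measurable \<mu> (P \<Otimes>\<^sub>M borel)"
      by (rule measurable_comp[OF fst measurable_graph])
    show "(\<lambda>p. p) \<in> measurable \<mu> (P \<Otimes>\<^sub>M borel)"
      by (simp add: measurable_cong_sets[OF sets refl])
  qed simp_all
  also have "\<dots> = \<mu>" by (rule distr_id2[OF sets[symmetric]])
  finally show ?thesis ..
qed

end

theorem proposition4p4: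
  fixes \<alpha> \<beta> \<sigma> :: real and P :: "(real \<Rightarrow> real) measure" and \<phi> :: cocycle
  assumes "1 < \<alpha>" and "\<alpha> < 2" and "\<sigma> \<noteq> 0"
    and "stable_noise \<alpha> P \<or> truncated_stable_noise \<alpha> P"
    and "generated_by_sde (\<lambda>x. \<beta> * x - x ^ 3) \<sigma> \<phi>"
  shows "\<exists>a. random_attractor P \<phi> (\<lambda>\<omega>. {a \<omega>}) \<and>
           (\<exists>\<mu>. markov_measure P \<phi> \<mu> \<and>
              is_disintegration P \<mu> (\<lambda>\<omega>. return borel (a \<omega>)) \<and>
              (\<forall>\<mu>'. invariant_measure P \<phi> \<mu>' \<longrightarrow> \<mu>' = \<mu>))"
proof -
  have "driven_flow \<beta> \<sigma> \<phi> P"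
    using stable_noise_unbounded[of \<alpha> P] assms
    by (intro driven_flow.intro cubic_flow.intro driven_flow_axioms.intro) auto
  then interpret driven_flow \<beta> \<sigma> \<phi> P .
  show ?thesis
    using random_attractor_upper_limit markov_graph_measure disintegration_graph_measure invariant_measure_unique
    by blast
qed

end
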